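(* Fix an integer $m\ge 3$ and let $C_{2m}$ be the cycle graph on $2m$ vertices. Then: (1) every group $\mathrm{MH}_{k,l}(C_{2m})$ is torsion-free; (2) define $T:\mathbb Z\times\mathbb Z\to\mathbb Z$ by $T(k,l)=0$ if $k<0$ or $l<0$; $T(0,0)=2m$, $T(1,1)=4m$; and $T(k,l)=\max\{T(k-1,l-1),\,T(k-2,l-m)\}$ for all other $(k,l)$ with $k,l\ge0$. Then $\operatorname{rk}\mathrm{MH}_{k,l}(C_{2m})=T(k,l)$ for all integers $k,l$.
   Context: $d$ denotes the shortest-path distance. For vertices $x_0,\dots,x_k$ put $\ell(x_0,\dots,x_k)=\sum_{i=0}^{k-1}d(x_i,x_{i+1})$. The magnitude chain complex: $\mathrm{MC}_{k,l}(G)$ is the free abelian group on $I_{k,l}(G)=\{(x_0,\dots,x_k)\in V(G)^{k+1}: x_i\neq x_{i+1}\ \forall i,\ \ell(x_0,\dots,x_k)=l\}$, with differential $\partial=\sum_{i=1}^{k-1}(-1)^i\partial_i:\mathrm{MC}_{k,l}\to\mathrm{MC}_{k-1,l}$, where $\partial_i(x_0,\dots,x_k)=(x_0,\dots,\hat x_i,\dots,x_k)$ if deleting $x_i$ does not change $\ell$, and $0$ otherwise. Magnitude homology: $\mathrm{MH}_{k,l}(G)=H_k(\mathrm{MC}_{*,l}(G))$ (with $\mathbb Z$ coefficients); $\operatorname{rk}$ denotes rank. *)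

theory Defs
  imports Main
begin

definition is_walk :: "'a set \<Rightarrow> ('a \<Rightarrow> 'a \<Rightarrow> bool) \<Rightarrow> 'a list \<Rightarrow> bool" where
  "is_walk V E p \<longleftrightarrow> p \<noteq> [] \<and> set p \<subseteq> V \<and>
     (\<forall>i. Suc i < length p \<longrightarrow> E (p ! i) (p ! Suc i))"

definition graph_dist :: "'a set \<Rightarrow> ('a \<Rightarrow> 'a \<Rightarrow> bool) \<Rightarrow> 'a \<Rightarrow> 'a \<Rightarrow> nat" where
  "graph_dist V E x y =
     (LEAST n. \<exists>p. is_walk V E p \<and> length p = Suc n \<and> hd p = x \<and> last p = y)"

definition cycle_V :: "nat \<Rightarrow> nat set" where
  "cycle_V n = {..<n}"

definition cycle_E :: "nat \<Rightarrow> nat \<Rightarrow> nat \<Rightarrow> bool" where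
  "cycle_E n x y \<longleftrightarrow> x < n \<and> y < n \<and> (y = Suc x mod n \<or> x = Suc y mod n)"

definition cycle_dist :: "nat \<Rightarrow> nat \<Rightarrow> nat \<Rightarrow> nat" where
  "cycle_dist n = graph_dist (cycle_V n) (cycle_E n)"

definition tuple_len :: "('a \<Rightarrow> 'a \<Rightarrow> nat) \<Rightarrow> 'a list \<Rightarrow> int" where
  "tuple_len d xs = (\<Sum>i<length xs - 1. int (d (xs ! i) (xs ! Suc i)))"

definition mc_gens :: "'a set \<Rightarrow> ('a \<Rightarrow> 'a \<Rightarrow> nat) \<Rightarrow> int \<Rightarrow> int \<Rightarrow> 'a list set" where
  "mc_gens V d k l = {xs. 0 \<le> k \<and> length xs = nat k + 1 \<and> set xs \<subseteq> V \<and>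
      (\<forall>i. Suc i < length xs \<longrightarrow> xs ! i \<noteq> xs ! Suc i) \<and> tuple_len d xs = l}"

text \<open>Chains in MC_{k,l}: integer combinations of generators, i.e. functions
  supported on I_{k,l} (which is finite for finite graphs).\<close>

definition mc_chains :: "'a set \<Rightarrow> ('a \<Rightarrow> 'a \<Rightarrow> nat) \<Rightarrow> int \<Rightarrow> int \<Rightarrow> ('a list \<Rightarrow> int) set" where
  "mc_chains V d k l = {c. \<forall>xs. c xs \<noteq> 0 \<longrightarrow> xs \<in> mc_gens V d k l}"

definition del_at :: "nat \<Rightarrow> 'a list \<Rightarrow> 'a list" where
  "del_at i xs = take i xs @ drop (Suc i) xs"

definition mc_bd :: "'a set \<Rightarrow> ('a \<Rightarrow> 'a \<Rightarrow> nat) \<Rightarrow> int \<Rightarrow> int \<Rightarrow> ('a list \<Rightarrow> int) \<Rightarrow> ('a list \<Rightarrow> int)" where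
  "mc_bd V d k l c = (\<lambda>ys. \<Sum>xs\<in>mc_gens V d k l. \<Sum>i\<in>{1..<nat k}.
      (if del_at i xs = ys \<and> tuple_len d (del_at i xs) = l then (-1) ^ i * c xs else 0))"

definition mh_cycles :: "'a set \<Rightarrow> ('a \<Rightarrow> 'a \<Rightarrow> nat) \<Rightarrow> int \<Rightarrow> int \<Rightarrow> ('a list \<Rightarrow> int) set" where
  "mh_cycles V d k l = {c \<in> mc_chains V d k l. mc_bd V d k l c = (\<lambda>_. 0)}"

definition mh_boundaries :: "'a set \<Rightarrow> ('a \<Rightarrow> 'a \<Rightarrow> nat) \<Rightarrow> int \<Rightarrow> int \<Rightarrow> ('a list \<Rightarrow> int) set" where
  "mh_boundaries V d k l = mc_bd V d (k + 1) l ` mc_chains V d (k + 1) l"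

text \<open>MH_{k,l} = cycles / boundaries.  It is torsion-free iff whenever a nonzero multiple
  of a cycle is a boundary, the cycle itself is a boundary.\<close>

definition mh_torsion_free :: "'a set \<Rightarrow> ('a \<Rightarrow> 'a \<Rightarrow> nat) \<Rightarrow> int \<Rightarrow> int \<Rightarrow> bool" where
  "mh_torsion_free V d k l \<longleftrightarrow>
     (\<forall>c\<in>mh_cycles V d k l. \<forall>n::int. n \<noteq> 0 \<and> (\<lambda>xs. n * c xs) \<in> mh_boundaries V d k l
        \<longrightarrow> c \<in> mh_boundaries V d k l)"

text \<open>Rank of MH_{k,l}: the maximal size r of a Z-linearly independent family of classes,
  i.e. of cycles z_0..z_{r-1} such that no nontrivial integer combination is a boundary.\<close>

definition mh_indep :: "'a set \<Rightarrow> ('a \<Rightarrow> 'a \<Rightarrow> nat) \<Rightarrow> int \<Rightarrow> int \<Rightarrow> nat \<Rightarrow> bool" where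
  "mh_indep V d k l r \<longleftrightarrow>
     (\<exists>z :: nat \<Rightarrow> 'a list \<Rightarrow> int. (\<forall>i<r. z i \<in> mh_cycles V d k l) \<and>
        (\<forall>a :: nat \<Rightarrow> int. (\<lambda>xs. \<Sum>i<r. a i * z i xs) \<in> mh_boundaries V d k l
            \<longrightarrow> (\<forall>i<r. a i = 0)))"

definition mh_rank :: "'a set \<Rightarrow> ('a \<Rightarrow> 'a \<Rightarrow> nat) \<Rightarrow> int \<Rightarrow> int \<Rightarrow> nat" where
  "mh_rank V d k l = (GREATEST r. mh_indep V d k l r)"

function T_fun :: "int \<Rightarrow> int \<Rightarrow> int \<Rightarrow> int" where
  "T_fun m k l =
     (if k < 0 \<or> l < 0 then 0
      else if k = 0 \<and> l = 0 then 2 * m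
      else if k = 1 \<and> l = 1 then 4 * m
      else max (T_fun m (k - 1) (l - 1)) (T_fun m (k - 2) (l - m)))"
  by pat_completeness auto
termination
  by (relation "measure (\<lambda>(m, k, l). nat (k + 1))") auto

end

theory Submission
  imports Defs "HOL.Modules" "HOL-Library.Function_Algebras"
begin

text \<open>
  Let \<open>U\<^sub>+\<close> and \<open>U\<^sub>-\<close> be the subcomplexes spanned by the tuples whose first step goes at most half
  way round the cycle in the positive, respectively negative, direction. Their sum is the whole
  complex, and their intersection is spanned in positive degrees by the tuples that start with an
  antipodal step, i.e. it is a copy of the whole complex shifted by \<open>(1, m)\<close>.
  The homotopy \<open>(x, x + j, \<dots>) \<mapsto> - (x, x + 1, x + j, \<dots>)\<close> retracts \<open>U\<^sub>+\<close> onto the tuples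
  \<open>(x, x + 1, \<dots>)\<close> that then turn back, a copy of \<open>U\<^sub>-\<close> shifted by \<open>(1, 1)\<close>; hence both halves are
  acyclic for \<open>k < l\<close>, and Mayer--Vietoris gives \<open>H\<^bsub>k,l\<^esub> = H\<^bsub>k-2,l-m\<^esub>\<close> there.
  On the diagonal there are no boundaries, and the cycles are the combinations of walks that turn
  back at every step, since vertices at distance 2 have a unique midpoint if \<open>m \<ge> 3\<close>.
\<close>

subsection \<open>Integer functions with prescribed support\<close>

definition supported_on :: "'a set \<Rightarrow> ('a \<Rightarrow> int) set" where
  "supported_on A = {c. \<forall>x. c x \<noteq> 0 \<longrightarrow> x \<in> A}"

lemma supported_onD: "c \<in> supported_on A \<Longrightarrow> c x \<noteq> 0 \<Longrightarrow> x \<in> A"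
  by (simp add: supported_on_def)

lemma supported_on_eq_0: "c \<in> supported_on A \<Longrightarrow> x \<notin> A \<Longrightarrow> c x = 0"
  using supported_onD by fastforce

lemma supported_on_mono: "A \<subseteq> B \<Longrightarrow> supported_on A \<subseteq> supported_on B"
  by (auto simp: supported_on_def)

lemma supported_on_Int: "supported_on (A \<inter> B) = supported_on A \<inter> supported_on B"
  by (auto simp: supported_on_def)

lemma supported_on_empty [simp]: "supported_on {} = {0}"
  by (auto simp: supported_on_def fun_eq_iff)

lemma zero_supported_on [simp]: "0 \<in> supported_on A"
  by (simp add: supported_on_def)

lemma supported_on_minus: "c \<in> supported_on A \<Longrightarrow> - c \<in> supported_on A"
  by (simp add: supported_on_def)

lemma supported_on_add: "c \<in> supported_on A \<Longrightarrow> e \<in> supported_on A \<Longrightarrow> c + e \<in> supported_on A"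
  by (auto simp: supported_on_def) (metis add.right_neutral)

lemma supported_on_diff: "c \<in> supported_on A \<Longrightarrow> e \<in> supported_on A \<Longrightarrow> c - e \<in> supported_on A"
  using supported_on_add[of c A "- e"] by (simp add: supported_on_minus)

lemma supported_on_combination:
  assumes "\<And>i. i \<in> I \<Longrightarrow> z i \<in> supported_on A"
  shows "(\<lambda>x. \<Sum>i\<in>I. a i * z i x) \<in> supported_on A"
  using assms by (fastforce simp: supported_on_def intro: sum.neutral)

lemma sum_fun_apply: "(\<Sum>i\<in>I. g i) x = (\<Sum>i\<in>I. g i x)"
  by (induction I rule: infinite_finite_induct) auto

lemma of_int_times_fun: "of_int n * c = (\<lambda>x. of_int n * c x)"
  for c :: "'a \<Rightarrow> 'b :: ring_1"
  by (cases n rule: int_diff_cases) (simp add: fun_eq_iff of_nat_fun_apply left_diff_distrib)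

lemma additive_of_int_mult:
  fixes f :: "'a :: ring_1 \<Rightarrow> 'b :: ring_1"
  assumes "additive f"
  shows "f (of_int n * x) = of_int n * f x"
proof (induction n rule: int_induct[where k = 0])
  case base
  show ?case by (simp add: additive.zero[OF assms])
next
  case (step1 n)
  then show ?case by (simp add: distrib_right additive.add[OF assms])
next
  case (step2 n)
  then show ?case by (simp add: left_diff_distrib additive.diff[OF assms])
qed

lemma additive_scale:
  fixes f :: "('a \<Rightarrow> int) \<Rightarrow> 'b \<Rightarrow> int"
  assumes "additive f"
  shows "f (\<lambda>x. n * c x) = (\<lambda>x. n * f c x)"
  using additive_of_int_mult[OF assms, of n c] by (simp add: of_int_times_fun)

lemma additive_combination:
  fixes f :: "('a \<Rightarrow> int) \<Rightarrow> 'b \<Rightarrow> int"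
  assumes "additive f"
  shows "f (\<lambda>x. \<Sum>i\<in>I. a i * z i x) = (\<lambda>x. \<Sum>i\<in>I. a i * f (z i) x)"
proof -
  have "(\<lambda>x. \<Sum>i\<in>I. a i * z i x) = (\<Sum>i\<in>I. (\<lambda>x. a i * z i x))"
    by (simp add: fun_eq_iff sum_fun_apply)
  then have "f (\<lambda>x. \<Sum>i\<in>I. a i * z i x) = (\<Sum>i\<in>I. (\<lambda>x. a i * f (z i) x))"
    by (simp only: additive.sum[OF assms] additive_scale[OF assms])
  then show ?thesis by (simp add: fun_eq_iff sum_fun_apply)
qed

lemma additive_compose: "additive f \<Longrightarrow> additive g \<Longrightarrow> additive (\<lambda>c. g (f c))"
  by (simp add: additive_def)

subsection \<open>Linear dependence over the integers\<close>

definition int_dependent :: "'i set \<Rightarrow> ('i \<Rightarrow> 'a \<Rightarrow> int) \<Rightarrow> bool" where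
  "int_dependent I v \<longleftrightarrow> (\<exists>a. (\<exists>i\<in>I. a i \<noteq> 0) \<and> (\<forall>x. (\<Sum>i\<in>I. a i * v i x) = 0))"

lemma int_dependentI:
  assumes "i \<in> I" "a i \<noteq> 0" "\<And>x. (\<Sum>i\<in>I. a i * v i x) = 0"
  shows "int_dependent I v"
  using assms unfolding int_dependent_def by blast

lemma int_dependent_pivot:
  fixes v :: "'i \<Rightarrow> 'a \<Rightarrow> int"
  assumes "finite I" "j \<in> I" "v j p \<noteq> 0"
    and dep: "int_dependent (I - {j}) (\<lambda>i x. v j p * v i x - v i p * v j x)"
  shows "int_dependent I v"
proof -
  obtain a i where i: "i \<in> I - {j}" "a i \<noteq> 0"
    and a: "\<And>x. (\<Sum>i\<in>I - {j}. a i * (v j p * v i x - v i p * v j x)) = 0"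
    using dep unfolding int_dependent_def by blast
  define a' where "a' i = (if i = j then - (\<Sum>i\<in>I - {j}. a i * v i p) else a i * v j p)" for i
  show ?thesis
  proof (rule int_dependentI)
    show "i \<in> I" "a' i \<noteq> 0" using i assms(3) by (auto simp: a'_def)
    fix x
    have "(\<Sum>i\<in>I. a' i * v i x) = a' j * v j x + (\<Sum>i\<in>I - {j}. a' i * v i x)"
      using assms(1,2) by (simp add: sum.remove)
    also have "(\<Sum>i\<in>I - {j}. a' i * v i x) = (\<Sum>i\<in>I - {j}. a i * v j p * v i x)"
      by (intro sum.cong) (auto simp: a'_def)
    also have "a' j * v j x + \<dots> = (\<Sum>i\<in>I - {j}. a i * (v j p * v i x - v i p * v j x))"
      by (simp add: a'_def algebra_simps sum_distrib_left sum_subtractf)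
    finally show "(\<Sum>i\<in>I. a' i * v i x) = 0" by (simp only: a)
  qed
qed

lemma int_dependent_if_card_less:
  assumes "finite A" "finite I" "card A < card I" "\<And>i. i \<in> I \<Longrightarrow> v i \<in> supported_on A"
  shows "int_dependent I v"
  using assms
proof (induction A arbitrary: I v rule: finite_induct)
  case empty
  then obtain i where "i \<in> I" by (force simp: card_gt_0_iff)
  then show ?case using empty by (intro int_dependentI[where a = "\<lambda>_. 1"]) simp_all
next
  case (insert p A)
  show ?case
  proof (cases "\<forall>i\<in>I. v i p = 0")
    case True
    then have "v i \<in> supported_on A" if "i \<in> I" for i
      using insert.prems(3)[OF that] that by (auto simp: supported_on_def)
    then show ?thesis using insert by (intro insert.IH) simp_all
  next
    case False
    then obtain j where j: "j \<in> I" "v j p \<noteq> 0" by blast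
    have "(\<lambda>x. v j p * v i x - v i p * v j x) \<in> supported_on A" if i: "i \<in> I - {j}" for i
    proof -
      have "v j p * v i x - v i p * v j x = 0" if "x \<notin> A" for x
        using supported_on_eq_0[OF insert.prems(3), of _ x] that i j(1) by (cases "x = p") simp_all
      then show ?thesis unfolding supported_on_def by blast
    qed
    then have "int_dependent (I - {j}) (\<lambda>i x. v j p * v i x - v i p * v j x)"
      using insert.prems insert.hyps j(1) by (intro insert.IH) simp_all
    then show ?thesis by (rule int_dependent_pivot[of I j v p, OF insert.prems(1) j])
  qed
qed

subsection \<open>Free quotients\<close>

text \<open>The witness \<open>f\<close> identifies \<open>Z / B\<close> with the free abelian group on \<open>A\<close>.\<close>

definition free_quotient :: "('b \<Rightarrow> int) set \<Rightarrow> ('b \<Rightarrow> int) set \<Rightarrow> 'a set \<Rightarrow> bool" where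
  "free_quotient Z B A \<longleftrightarrow>
     (\<exists>f. additive f \<and> f ` Z = supported_on A \<and> (\<forall>c\<in>Z. f c = 0 \<longleftrightarrow> c \<in> B))"

lemma free_quotient_transport:
  assumes free: "free_quotient Z' B' A" and F: "additive F" "F ` Z \<subseteq> Z'" and "B' \<subseteq> Z'"
    and ker: "\<And>c. c \<in> Z \<Longrightarrow> F c \<in> B' \<longleftrightarrow> c \<in> B"
    and onto: "\<And>y. y \<in> Z' \<Longrightarrow> \<exists>c\<in>Z. F c - y \<in> B'"
  shows "free_quotient Z B A"
proof -
  obtain f where f: "additive f" "f ` Z' = supported_on A" and f_ker: "\<forall>y\<in>Z'. f y = 0 \<longleftrightarrow> y \<in> B'"
    using free unfolding free_quotient_def by blast
  have "g \<in> (\<lambda>c. f (F c)) ` Z" if "g \<in> supported_on A" for g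
  proof -
    have "g \<in> f ` Z'" using that f(2) by simp
    then obtain y where y: "y \<in> Z'" "f y = g" by blast
    then obtain c where c: "c \<in> Z" "F c - y \<in> B'" using onto by blast
    then have "f (F c - y) = 0" using f_ker \<open>B' \<subseteq> Z'\<close> by blast
    then have "f (F c) = g" using y(2) by (simp add: additive.diff[OF f(1)])
    then show ?thesis using c(1) by blast
  qed
  then have "(\<lambda>c. f (F c)) ` Z = supported_on A" using F(2) f(2) by blast
  moreover have "additive (\<lambda>c. f (F c))" using F(1) f(1) by (rule additive_compose)
  ultimately show ?thesis unfolding free_quotient_def
    using F(2) f_ker ker by (intro exI[of _ "\<lambda>c. f (F c)"]) blast
qed

lemma free_quotient_self: "Z \<noteq> {} \<Longrightarrow> free_quotient Z Z {}"
  unfolding free_quotient_def by (intro exI[of _ "\<lambda>_. 0"]) (auto simp: additive_def)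

lemma free_quotient_supported_on: "free_quotient (supported_on A) {0} A"
  unfolding free_quotient_def by (intro exI[of _ "\<lambda>c. c"]) (simp add: additive_def)

subsection \<open>Torsion and rank of magnitude homology\<close>

lemma additive_mc_bd: "additive (mc_bd V d k l)"
proof (standard, rule ext)
  fix c e ys
  show "mc_bd V d k l (c + e) ys = (mc_bd V d k l c + mc_bd V d k l e) ys"
    unfolding mc_bd_def plus_fun_apply sum.distrib[symmetric]
    by (intro sum.cong refl) (auto simp: distrib_left)
qed

lemma mh_cycles_combination:
  assumes "\<And>i. i \<in> I \<Longrightarrow> z i \<in> mh_cycles V d k l"
  shows "(\<lambda>xs. \<Sum>i\<in>I. a i * z i xs) \<in> mh_cycles V d k l"
proof -
  have "mc_chains V d k l = supported_on (mc_gens V d k l)"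
    by (simp add: mc_chains_def supported_on_def)
  then have "(\<lambda>xs. \<Sum>i\<in>I. a i * z i xs) \<in> mc_chains V d k l"
    using assms by (simp add: mh_cycles_def supported_on_combination)
  moreover have "(\<Sum>i\<in>I. a i * mc_bd V d k l (z i) ys) = 0" for ys
    using assms by (intro sum.neutral) (simp add: mh_cycles_def)
  ultimately show ?thesis by (simp add: mh_cycles_def additive_combination[OF additive_mc_bd])
qed

lemma mh_torsion_free_if_free_quotient:
  fixes V :: "'a set" and A :: "'b set"
  assumes "free_quotient (mh_cycles V d k l) (mh_boundaries V d k l) A"
  shows "mh_torsion_free V d k l"
  unfolding mh_torsion_free_def
proof (intro ballI allI impI, elim conjE)
  fix c and n :: int
  assume c: "c \<in> mh_cycles V d k l" and n: "n \<noteq> 0" "(\<lambda>xs. n * c xs) \<in> mh_boundaries V d k l"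
  obtain f :: "('a list \<Rightarrow> int) \<Rightarrow> 'b \<Rightarrow> int" where f: "additive f"
    and ker: "\<forall>c\<in>mh_cycles V d k l. f c = 0 \<longleftrightarrow> c \<in> mh_boundaries V d k l"
    using assms unfolding free_quotient_def by blast
  have "(\<lambda>xs. n * c xs) \<in> mh_cycles V d k l"
    using mh_cycles_combination[of "{()}" "\<lambda>_. c" V d k l "\<lambda>_. n"] c by simp
  then have "(\<lambda>x. n * f c x) = 0" using n(2) ker by (simp flip: additive_scale[OF f])
  then have "f c = 0" using n(1) by (simp add: fun_eq_iff)
  then show "c \<in> mh_boundaries V d k l" using ker c by blast
qed

lemma card_ge_if_mh_indep:
  assumes "free_quotient (mh_cycles V d k l) (mh_boundaries V d k l) A" "finite A"
    and "mh_indep V d k l r"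
  shows "r \<le> card A"
proof (rule ccontr)
  assume "\<not> r \<le> card A"
  obtain f where f: "additive f" "f ` mh_cycles V d k l = supported_on A"
    and ker: "\<forall>c\<in>mh_cycles V d k l. f c = 0 \<longleftrightarrow> c \<in> mh_boundaries V d k l"
    using assms(1) unfolding free_quotient_def by blast
  obtain z where z: "\<And>i. i < r \<Longrightarrow> z i \<in> mh_cycles V d k l"
    and indep: "\<And>a i. (\<lambda>xs. \<Sum>i<r. a i * z i xs) \<in> mh_boundaries V d k l \<Longrightarrow> i < r \<Longrightarrow> a i = 0"
    using assms(3) unfolding mh_indep_def by blast
  have "int_dependent {..<r} (\<lambda>i. f (z i))"
    using \<open>\<not> r \<le> card A\<close> z f(2) by (intro int_dependent_if_card_less[OF \<open>finite A\<close>]) auto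
  then obtain a i where a: "i < r" "a i \<noteq> 0" "\<And>x. (\<Sum>i<r. a i * f (z i) x) = 0"
    unfolding int_dependent_def by blast
  have "(\<lambda>xs. \<Sum>i<r. a i * z i xs) \<in> mh_cycles V d k l"
    using z by (intro mh_cycles_combination) simp
  moreover have "f (\<lambda>xs. \<Sum>i<r. a i * z i xs) = 0"
    by (simp add: additive_combination[OF f(1)] a(3) fun_eq_iff)
  ultimately have "(\<lambda>xs. \<Sum>i<r. a i * z i xs) \<in> mh_boundaries V d k l" using ker by blast
  then show False using indep a(1,2) by blast
qed

lemma mh_indep_card:
  assumes "free_quotient (mh_cycles V d k l) (mh_boundaries V d k l) A" "finite A"
  shows "mh_indep V d k l (card A)"
proof -
  obtain f where f: "additive f" "f ` mh_cycles V d k l = supported_on A"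
    and ker: "\<forall>c\<in>mh_cycles V d k l. f c = 0 \<longleftrightarrow> c \<in> mh_boundaries V d k l"
    using assms(1) unfolding free_quotient_def by blast
  obtain p where p: "bij_betw p {..<card A} A"
    using ex_bij_betw_nat_finite[OF \<open>finite A\<close>] by (auto simp: atLeast0LessThan)
  have "(\<lambda>x. if x = p i then 1 else 0) \<in> f ` mh_cycles V d k l" if "i < card A" for i
    using bij_betwE[OF p] that by (auto simp: f(2) supported_on_def)
  then have "\<forall>i. \<exists>c. i < card A \<longrightarrow> c \<in> mh_cycles V d k l \<and> f c = (\<lambda>x. if x = p i then 1 else 0)"
    by (metis (no_types, lifting) imageE)
  then obtain z where z: "\<And>i. i < card A \<Longrightarrow> z i \<in> mh_cycles V d k l"
      "\<And>i. i < card A \<Longrightarrow> f (z i) = (\<lambda>x. if x = p i then 1 else 0)"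
    by metis
  have "a j = 0"
    if B: "(\<lambda>xs. \<Sum>i<card A. a i * z i xs) \<in> mh_boundaries V d k l" and j: "j < card A" for a j
  proof -
    have "(\<lambda>xs. \<Sum>i<card A. a i * z i xs) \<in> mh_cycles V d k l"
      using z(1) by (intro mh_cycles_combination) simp
    then have "f (\<lambda>xs. \<Sum>i<card A. a i * z i xs) = 0" using ker B by blast
    then have "0 = (\<Sum>i<card A. a i * f (z i) (p j))"
      by (simp add: additive_combination[OF f(1)] fun_eq_iff)
    also have "\<dots> = (\<Sum>i<card A. if i = j then a i else 0)"
      using bij_betw_imp_inj_on[OF p] j z(2) by (intro sum.cong refl) (auto simp: inj_on_def)
    also have "\<dots> = a j" using j by simp
    finally show ?thesis by simp
  qed
  then show ?thesis unfolding mh_indep_def using z(1) by (intro exI[of _ z]) blast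
qed

lemma mh_rank_eq_card:
  assumes "free_quotient (mh_cycles V d k l) (mh_boundaries V d k l) A" "finite A"
  shows "mh_rank V d k l = card A"
  unfolding mh_rank_def
  using mh_indep_card[OF assms] card_ge_if_mh_indep[OF assms] by (rule Greatest_equality)

subsection \<open>Inserting a point into a tuple\<close>

definition insert_at :: "nat \<Rightarrow> 'a \<Rightarrow> 'a list \<Rightarrow> 'a list" where
  "insert_at i v xs = take i xs @ v # drop i xs"

lemma insert_at_Cons [simp]: "insert_at (Suc i) v (x # xs) = x # insert_at i v xs"
  by (simp add: insert_at_def)

lemma length_insert_at [simp]: "length (insert_at i v xs) = Suc (length xs)"
  by (simp add: insert_at_def)

lemma nth_insert_at:
  "i \<le> length xs \<Longrightarrow>
    insert_at i v xs ! j = (if j < i then xs ! j else if j = i then v else xs ! (j - 1))"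
  by (auto simp: insert_at_def nth_append nth_Cons' le_imp_diff_is_add)

lemma del_at_insert_at [simp]: "i \<le> length xs \<Longrightarrow> del_at i (insert_at i v xs) = xs"
  by (simp add: insert_at_def del_at_def)

lemma insert_at_del_at: "i < length xs \<Longrightarrow> insert_at i (xs ! i) (del_at i xs) = xs"
  by (simp add: insert_at_def del_at_def flip: id_take_nth_drop)

lemma insert_at_between_neighbours:
  assumes "0 < i" "i < length xs"
  obtains p x y q where "xs = p @ x # y # q" "xs ! (i - 1) = x" "xs ! i = y"
    "insert_at i v xs = p @ x # v # y # q"
proof -
  define p x y q where "p = take (i - 1) xs" and "x = xs ! (i - 1)" and "y = xs ! i"
    and "q = drop (Suc i) xs"
  have take: "take i xs = p @ [x]"
    using assms take_Suc_conv_app_nth[of "i - 1" xs] by (simp add: p_def x_def)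
  have drop: "drop i xs = y # q" using assms by (simp add: y_def q_def Cons_nth_drop_Suc)
  show thesis
  proof (rule that)
    show "xs = p @ x # y # q" using append_take_drop_id[of i xs] by (simp add: take drop)
    show "insert_at i v xs = p @ x # v # y # q" by (simp add: insert_at_def take drop)
  qed (simp_all add: x_def y_def)
qed

subsection \<open>The magnitude chain complex of a finite metric space\<close>

locale finite_metric =
  fixes V :: "'a set" and d :: "'a \<Rightarrow> 'a \<Rightarrow> nat"
  assumes finite_V: "finite V"
    and d_eq_0_iff: "x \<in> V \<Longrightarrow> y \<in> V \<Longrightarrow> d x y = 0 \<longleftrightarrow> x = y"
    and d_commute: "x \<in> V \<Longrightarrow> y \<in> V \<Longrightarrow> d x y = d y x"
    and d_triangle: "x \<in> V \<Longrightarrow> y \<in> V \<Longrightarrow> z \<in> V \<Longrightarrow> d x z \<le> d x y + d y z"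
begin

definition between :: "'a \<Rightarrow> 'a \<Rightarrow> 'a set" where
  "between x z = {v \<in> V. x \<in> V \<and> z \<in> V \<and> v \<noteq> x \<and> v \<noteq> z \<and> d x v + d v z = d x z}"

lemma between_iff:
  assumes "x \<in> V" "v \<in> V" "z \<in> V"
  shows "v \<in> between x z \<longleftrightarrow> 0 < d x v \<and> 0 < d v z \<and> d x v + d v z = d x z"
  using assms d_eq_0_iff[of x v] d_eq_0_iff[of v z] by (auto simp: between_def)

lemma betweenD:
  assumes "v \<in> between x z"
  shows "v \<in> V" "x \<in> V" "z \<in> V" "v \<noteq> x" "v \<noteq> z" "x \<noteq> z" "d x v + d v z = d x z"
  using assms d_eq_0_iff[of x v] d_eq_0_iff[of x x] by (auto simp: between_def)

lemma finite_between [simp]: "finite (between x z)"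
  using finite_V by (simp add: between_def)

lemma between_self [simp]: "between x x = {}"
  using betweenD(6) by blast

lemma between_chain_iff:
  "v \<in> between x z \<and> w \<in> between x v \<longleftrightarrow> w \<in> between x z \<and> v \<in> between w z"
proof (cases "x \<in> V \<and> z \<in> V \<and> v \<in> V \<and> w \<in> V")
  case True
  then have "d x z \<le> d x w + d w z" "d w z \<le> d w v + d v z" "d x z \<le> d x v + d v z"
      "d x v \<le> d x w + d w v"
    by (simp_all add: d_triangle)
  with True show ?thesis by (simp add: between_iff) linarith
qed (auto simp: between_def)

fun len :: "'a list \<Rightarrow> nat" where
  "len (x # y # t) = d x y + len (y # t)"
| "len _ = 0"

lemma len_append: "len (xs @ y # ys) = len (xs @ [y]) + len (y # ys)"
  by (induction xs rule: induct_list012) simp_all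

lemma length_le_Suc_len: "set xs \<subseteq> V \<Longrightarrow> distinct_adj xs \<Longrightarrow> length xs \<le> Suc (len xs)"
proof (induction xs rule: induct_list012)
  case (3 x y t)
  then have "0 < d x y" using d_eq_0_iff[of x y] by auto
  then show ?case using 3 by auto
qed auto

definition generators :: "nat \<Rightarrow> nat \<Rightarrow> 'a list set" where
  "generators k l = {xs. length xs = Suc k \<and> set xs \<subseteq> V \<and> distinct_adj xs \<and> len xs = l}"

lemma generators_0_iff: "xs \<in> generators 0 l \<longleftrightarrow> l = 0 \<and> (\<exists>x\<in>V. xs = [x])"
  by (auto simp: generators_def length_Suc_conv)

lemma generators_SucE:
  assumes "xs \<in> generators (Suc k) l"
  obtains x y t where "xs = x # y # t"
  using assms by (cases xs rule: remdups_adj.cases) (auto simp: generators_def)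

lemma Cons_Cons_generators_iff:
  "x # y # t \<in> generators (Suc k) l \<longleftrightarrow>
    x \<in> V \<and> x \<noteq> y \<and> d x y \<le> l \<and> y # t \<in> generators k (l - d x y)"
  by (auto simp: generators_def)

lemma Cons_generatorsD: "x # t \<in> generators k l \<Longrightarrow> x \<in> V"
  by (simp add: generators_def)

lemma generators_empty: "l < k \<Longrightarrow> generators k l = {}"
  using length_le_Suc_len by (fastforce simp: generators_def)

lemma finite_generators: "finite (generators k l)"
  by (rule finite_subset[OF _ finite_lists_length_eq[OF finite_V, of "Suc k"]])
    (auto simp: generators_def)

lemma insert_at_generators_iff:
  assumes "0 < i" "i < length ys" "v \<in> between (ys ! (i - 1)) (ys ! i)"
  shows "insert_at i v ys \<in> generators (Suc k) l \<longleftrightarrow> ys \<in> generators k l"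
proof -
  obtain p x y q where ys: "ys = p @ x # y # q" and xy: "ys ! (i - 1) = x" "ys ! i = y"
    and ins: "insert_at i v ys = p @ x # v # y # q"
    using assms(1,2) by (rule insert_at_between_neighbours[where v = v])
  have "v \<in> V" "x \<noteq> v" "v \<noteq> y" "x \<noteq> y" "d x v + d v y = d x y"
    using betweenD[OF assms(3)[unfolded xy]] by auto
  then show ?thesis
    unfolding ins by (auto simp: ys generators_def distinct_adj_append_iff
        len_append[of p x "y # q"] len_append[of p x "v # y # q"])
qed

lemma between_iff_len_insert_at:
  assumes "0 < i" "i < length ys" "insert_at i v ys \<in> generators (Suc k) l"
  shows "v \<in> between (ys ! (i - 1)) (ys ! i) \<longleftrightarrow> len ys = l"
proof -
  obtain p x y q where ys: "ys = p @ x # y # q" and xy: "ys ! (i - 1) = x" "ys ! i = y"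
    and ins: "insert_at i v ys = p @ x # v # y # q"
    using assms(1,2) by (rule insert_at_between_neighbours[where v = v])
  have "x \<in> V" "v \<in> V" "y \<in> V" "x \<noteq> v" "v \<noteq> y" and l: "len (p @ x # v # y # q) = l"
    using assms(3) unfolding ins by (auto simp: generators_def distinct_adj_append_iff)
  then have "v \<in> between x y \<longleftrightarrow> d x v + d v y = d x y" by (auto simp: between_def)
  moreover have "len ys = len (p @ [x]) + d x y + len (y # q)"
    by (simp add: ys len_append[of p x "y # q"])
  moreover have "l = len (p @ [x]) + d x v + d v y + len (y # q)"
    using l by (simp add: len_append[of p x "v # y # q"])
  ultimately show ?thesis unfolding xy by linarith
qed

definition chains :: "nat \<Rightarrow> nat \<Rightarrow> ('a list \<Rightarrow> int) set" where
  "chains k l = supported_on (generators k l)"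

lemma chains_zero [simp]: "0 \<in> chains k l"
  by (simp add: chains_def)

lemma chains_minus: "c \<in> chains k l \<Longrightarrow> - c \<in> chains k l"
  by (simp add: chains_def supported_on_minus)

lemma chains_add: "c \<in> chains k l \<Longrightarrow> e \<in> chains k l \<Longrightarrow> c + e \<in> chains k l"
  by (simp add: chains_def supported_on_add)

lemma chains_diff: "c \<in> chains k l \<Longrightarrow> e \<in> chains k l \<Longrightarrow> c - e \<in> chains k l"
  by (simp add: chains_def supported_on_diff)

lemma chains_trivial: "l < k \<Longrightarrow> chains k l = {0}"
  by (simp add: chains_def generators_empty)

lemma chains_0_trivial: "0 < l \<Longrightarrow> chains 0 l = {0}"
proof -
  assume "0 < l"
  then have "generators 0 l = {}" by (auto simp: generators_0_iff)
  then show ?thesis by (simp add: chains_def)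
qed

lemma chains_nonzero_Cons_Cons:
  assumes "c \<in> chains k l" "c (x # y # t) \<noteq> 0"
  shows "x \<in> V" "y \<in> V" "x \<noteq> y"
  using supported_onD[OF assms[unfolded chains_def]] by (auto simp: generators_def)

text \<open>A tuple arises by a length-preserving deletion exactly from its length-preserving insertions,
  which makes the boundary independent of the degree and of the length.\<close>

definition bd :: "('a list \<Rightarrow> int) \<Rightarrow> 'a list \<Rightarrow> int" where
  "bd c ys = (\<Sum>i\<in>{1..<length ys}.
     (-1) ^ i * (\<Sum>v\<in>between (ys ! (i - 1)) (ys ! i). c (insert_at i v ys)))"

lemma bd_Nil [simp]: "bd c [] = 0" and bd_singleton [simp]: "bd c [x] = 0"
  by (simp_all add: bd_def)

lemma bd_Cons_Cons [simp]:
  "bd c (y # z # r) = - (\<Sum>v\<in>between y z. c (y # v # z # r)) - bd (\<lambda>t. c (y # t)) (z # r)"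
proof -
  let ?f = "\<lambda>i. (-1) ^ i * (\<Sum>v\<in>between ((y # z # r) ! (i - 1)) ((y # z # r) ! i).
    c (insert_at i v (y # z # r)))"
  have "bd c (y # z # r) = ?f 1 + (\<Sum>i\<in>{Suc 1..<Suc (length (z # r))}. ?f i)"
    unfolding bd_def by (subst sum.atLeast_Suc_lessThan) simp_all
  also have "(\<Sum>i\<in>{Suc 1..<Suc (length (z # r))}. ?f i) = (\<Sum>i\<in>{1..<length (z # r)}. ?f (Suc i))"
    by (rule sum.shift_bounds_Suc_ivl)
  also have "\<dots> = - bd (\<lambda>t. c (y # t)) (z # r)"
    unfolding bd_def sum_negf[symmetric]
    by (intro sum.cong refl) (auto simp: nth_Cons split: nat.split)
  finally show ?thesis by (simp add: insert_at_def)
qed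

lemma additive_bd: "additive bd"
proof (standard, rule ext)
  show "bd (c + e) ys = (bd c + bd e) ys" for c e ys
    by (simp add: bd_def sum.distrib distrib_left)
qed

sublocale bd: additive bd
  by (rule additive_bd)

lemma bd_nonzeroE:
  assumes "bd c ys \<noteq> 0"
  obtains i v where "0 < i" "i < length ys" "v \<in> between (ys ! (i - 1)) (ys ! i)"
    "c (insert_at i v ys) \<noteq> 0"
proof -
  obtain i where i: "i \<in> {1..<length ys}"
    "(\<Sum>v\<in>between (ys ! (i - 1)) (ys ! i). c (insert_at i v ys)) \<noteq> 0"
    using assms unfolding bd_def by (metis (no_types, lifting) mult_zero_right sum.neutral)
  then obtain v where "v \<in> between (ys ! (i - 1)) (ys ! i)" "c (insert_at i v ys) \<noteq> 0"
    by (meson sum.neutral)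
  then show thesis by (rule that[rotated 2]) (use i(1) in auto)
qed

lemma bd_cong:
  assumes "\<And>s. f (z # s) = g (z # s)"
  shows "bd f (z # r) = bd g (z # r)"
  using assms by (cases r) simp_all

lemma bd_chains: "c \<in> chains (Suc k) l \<Longrightarrow> bd c \<in> chains k l"
  unfolding chains_def supported_on_def by (auto elim!: bd_nonzeroE simp: insert_at_generators_iff)

lemma bd_chains_0:
  assumes "c \<in> chains 0 l" shows "bd c = 0"
proof (rule ext, rule ccontr)
  fix ys assume "bd c ys \<noteq> 0 ys"
  then obtain i v where "i < length ys" "insert_at i v ys \<in> generators 0 l"
    using supported_onD[of c] assms unfolding chains_def by (auto elim!: bd_nonzeroE)
  then show False by (simp add: generators_def)
qed

lemma bd_chains_pred: "c \<in> chains k l \<Longrightarrow> bd c \<in> chains (k - 1) l"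
  using bd_chains_0 bd_chains by (cases k) simp_all

theorem bd_bd: "bd (bd c) = 0"
proof
  show "bd (bd c) xs = 0 xs" for xs
  proof (induction xs arbitrary: c rule: induct_list012)
    case (3 y z r)
    have "bd (\<lambda>t. bd c (y # t)) (z # r)
        = bd (- (\<Sum>v\<in>between y z. (\<lambda>t. c (y # v # t))) - bd (\<lambda>t. c (y # t))) (z # r)"
      by (rule bd_cong) (simp add: sum_fun_apply)
    also have "\<dots> = - (\<Sum>v\<in>between y z. bd (\<lambda>t. c (y # v # t)) (z # r))"
      using 3(2)[of "\<lambda>t. c (y # t)"] by (simp add: bd.diff bd.minus bd.sum sum_fun_apply)
    finally have tail: "bd (\<lambda>t. bd c (y # t)) (z # r) = \<dots>" .
    have "(\<Sum>v\<in>between y z. \<Sum>w\<in>between y v. c (y # w # v # z # r))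
        = (\<Sum>(v, w)\<in>Sigma (between y z) (\<lambda>v. between y v). c (y # w # v # z # r))"
      by (simp add: sum.Sigma)
    also have "\<dots> = (\<Sum>(v, w)\<in>Sigma (between y z) (\<lambda>v. between v z). c (y # v # w # z # r))"
      by (rule sum.reindex_bij_witness[of _ prod.swap prod.swap])
        (auto dest: between_chain_iff[THEN iffD1, OF conjI] between_chain_iff[THEN iffD2, OF conjI])
    also have "\<dots> = (\<Sum>v\<in>between y z. \<Sum>w\<in>between v z. c (y # v # w # z # r))"
      by (simp add: sum.Sigma)
    finally show ?case
      using tail by (simp add: sum_subtractf sum.distrib sum_negf)
  qed auto
qed

abbreviation cycles ::
    "(nat \<Rightarrow> nat \<Rightarrow> ('a list \<Rightarrow> int) set) \<Rightarrow> nat \<Rightarrow> nat \<Rightarrow> ('a list \<Rightarrow> int) set" where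
  "cycles C k l \<equiv> {c \<in> C k l. bd c = 0}"

abbreviation boundaries ::
    "(nat \<Rightarrow> nat \<Rightarrow> ('a list \<Rightarrow> int) set) \<Rightarrow> nat \<Rightarrow> nat \<Rightarrow> ('a list \<Rightarrow> int) set" where
  "boundaries C k l \<equiv> bd ` C (Suc k) l"

definition exact_at :: "(nat \<Rightarrow> nat \<Rightarrow> ('a list \<Rightarrow> int) set) \<Rightarrow> nat \<Rightarrow> nat \<Rightarrow> bool" where
  "exact_at C k l \<longleftrightarrow> cycles C k l \<subseteq> boundaries C k l"

lemma exact_atE:
  assumes "exact_at C k l" "c \<in> C k l" "bd c = 0"
  obtains e where "e \<in> C (Suc k) l" "bd e = c"
  using assms unfolding exact_at_def by blast

definition free_homology :: "(nat \<Rightarrow> nat \<Rightarrow> ('a list \<Rightarrow> int) set) \<Rightarrow> nat \<Rightarrow> nat \<Rightarrow> 'b set \<Rightarrow> bool" where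
  "free_homology C k l A \<longleftrightarrow> free_quotient (cycles C k l) (boundaries C k l) A"

lemma free_homology_if_trivial:
  assumes "C k l = {0}" "0 \<in> C (Suc k) l" "boundaries C k l \<subseteq> C k l"
  shows "free_homology C k l {}"
proof -
  have "cycles C k l = {0}" "boundaries C k l = {0}"
    using assms by (auto simp: bd.zero image_iff intro!: bexI[of _ 0])
  then show ?thesis using free_quotient_self[of "{0}"] by (simp add: free_homology_def)
qed

lemma free_homology_chains_trivial: "chains k l = {0} \<Longrightarrow> free_homology chains k l {}"
  using bd_chains by (intro free_homology_if_trivial) auto

subsection \<open>Comparison with the magnitude complex\<close>

lemma tuple_len_eq: "tuple_len d xs = int (len xs)"
  by (induction xs rule: induct_list012)
    (simp_all add: tuple_len_def sum.lessThan_Suc_shift del: sum.lessThan_Suc)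

lemma mc_gens_eq: "mc_gens V d (int k) (int l) = generators k l"
  by (auto simp: mc_gens_def generators_def tuple_len_eq distinct_adj_conv_nth)

lemma mc_chains_eq: "mc_chains V d (int k) (int l) = chains k l"
  by (simp add: mc_chains_def chains_def supported_on_def mc_gens_eq)

lemma del_at_generators:
  assumes xs: "xs \<in> generators (Suc k) l" and i: "0 < i" "i \<le> k" and len: "len (del_at i xs) = l"
  shows "del_at i xs \<in> generators k l"
    and "xs ! i \<in> between (del_at i xs ! (i - 1)) (del_at i xs ! i)"
proof -
  have ins: "insert_at i (xs ! i) (del_at i xs) \<in> generators (Suc k) l"
    using xs i insert_at_del_at[of i xs] by (simp add: generators_def)
  have i': "0 < i" "i < length (del_at i xs)"
    using xs i by (simp_all add: generators_def del_at_def)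
  show mid: "xs ! i \<in> between (del_at i xs ! (i - 1)) (del_at i xs ! i)"
    using between_iff_len_insert_at[OF i' ins] len by simp
  show "del_at i xs \<in> generators k l" using insert_at_generators_iff[OF i' mid] ins by simp
qed

lemma generators_del_at_eq:
  assumes "0 < i" "i < length ys" and ys: "ys \<in> generators k l"
  shows "{xs \<in> generators (Suc k) l. del_at i xs = ys}
    = (\<lambda>v. insert_at i v ys) ` between (ys ! (i - 1)) (ys ! i)" (is "?L = ?R")
proof
  show "?R \<subseteq> ?L" using assms by (auto simp: insert_at_generators_iff)
  show "?L \<subseteq> ?R"
  proof
    fix xs assume xs: "xs \<in> ?L"
    then have "insert_at i (xs ! i) ys = xs"
      using assms insert_at_del_at[of i xs] by (auto simp: generators_def)
    moreover have "xs ! i \<in> between (ys ! (i - 1)) (ys ! i)"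
      using del_at_generators(2)[of xs k l i] xs assms by (auto simp: generators_def)
    ultimately show "xs \<in> ?R" by (metis image_eqI)
  qed
qed

lemma mc_bd_eq_on_generator:
  assumes ys: "ys \<in> generators k l"
  shows "mc_bd V d (int (Suc k)) (int l) c ys = bd c ys"
proof -
  have "mc_bd V d (int (Suc k)) (int l) c ys
      = (\<Sum>i\<in>{1..<Suc k}. \<Sum>xs\<in>generators (Suc k) l. if del_at i xs = ys then (-1) ^ i * c xs else 0)"
    unfolding mc_bd_def mc_gens_eq nat_int
    by (subst sum.swap, intro sum.cong refl) (use ys in \<open>auto simp: tuple_len_eq generators_def\<close>)
  also have "\<dots> = bd c ys"
  proof -
    have "(\<Sum>xs\<in>generators (Suc k) l. if del_at i xs = ys then (-1) ^ i * c xs else 0)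
        = (-1) ^ i * (\<Sum>v\<in>between (ys ! (i - 1)) (ys ! i). c (insert_at i v ys))"
      if i: "0 < i" "i < length ys" for i
    proof -
      have "inj_on (\<lambda>v. insert_at i v ys) (between (ys ! (i - 1)) (ys ! i))"
        using i by (intro inj_on_inverseI[where g = "\<lambda>xs. xs ! i"]) (simp add: nth_insert_at)
      moreover have "(\<Sum>xs\<in>generators (Suc k) l. if del_at i xs = ys then (-1) ^ i * c xs else 0)
          = (\<Sum>xs\<in>{xs \<in> generators (Suc k) l. del_at i xs = ys}. (-1) ^ i * c xs)"
        by (simp add: sum.inter_filter finite_generators)
      ultimately show ?thesis
        by (simp add: generators_del_at_eq[OF i ys] sum.reindex sum_distrib_left)
    qed
    moreover have "length ys = Suc k" using ys by (simp add: generators_def)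
    ultimately show ?thesis unfolding bd_def by (intro sum.cong) auto
  qed
  finally show ?thesis .
qed

lemma mc_bd_eq:
  assumes c: "c \<in> chains k l"
  shows "mc_bd V d (int k) (int l) c = bd c"
proof (cases k)
  case 0
  then show ?thesis using c bd_chains_0 by (simp add: mc_bd_def fun_eq_iff)
next
  case (Suc k')
  show ?thesis
  proof
    fix ys
    show "mc_bd V d (int k) (int l) c ys = bd c ys"
    proof (cases "ys \<in> generators k' l")
      case True
      then show ?thesis unfolding Suc by (rule mc_bd_eq_on_generator)
    next
      case False
      have "ys \<in> generators k' l"
        if "xs \<in> generators k l" "i \<in> {1..<k}" "del_at i xs = ys" "len ys = l" for xs i
        using that Suc del_at_generators(1)[of xs k' l i] by simp
      then have "mc_bd V d (int k) (int l) c ys = 0"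
        using False unfolding mc_bd_def mc_gens_eq nat_int
        by (intro sum.neutral ballI) (auto simp: tuple_len_eq)
      moreover have "bd c ys = 0"
        using bd_chains[of c k' l] c False Suc supported_on_eq_0 by (auto simp: chains_def)
      ultimately show ?thesis by simp
    qed
  qed
qed

lemma mh_cycles_eq: "mh_cycles V d (int k) (int l) = cycles chains k l"
  unfolding mh_cycles_def mc_chains_eq zero_fun_def using mc_bd_eq by auto

lemma mh_boundaries_eq: "mh_boundaries V d (int k) (int l) = boundaries chains k l"
  using mc_chains_eq[of "Suc k"] mc_bd_eq[of _ "Suc k"]
  by (auto simp: mh_boundaries_def add.commute)

lemma free_quotient_mh_if_free_homology:
  assumes "free_homology chains k l A"
  shows "free_quotient (mh_cycles V d (int k) (int l)) (mh_boundaries V d (int k) (int l)) A"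
  using assms by (simp add: free_homology_def mh_cycles_eq mh_boundaries_eq)

lemma free_quotient_mh_negative:
  assumes "k < 0 \<or> l < 0"
  shows "free_quotient (mh_cycles V d k l) (mh_boundaries V d k l) {}"
proof -
  have zero: "mc_bd V d j l 0 = 0" for j
    by (rule additive.zero[OF additive_mc_bd])
  have chains: "mc_chains V d j l = {0}" if "j < 0 \<or> l < 0" for j
    using that by (auto simp: mc_chains_def mc_gens_def tuple_len_eq fun_eq_iff)
  have "mh_cycles V d k l = {0}"
    using chains[OF assms] zero by (auto simp: mh_cycles_def zero_fun_def)
  moreover have "mh_boundaries V d k l = {0}"
  proof (cases "k = - 1")
    case True
    have "0 \<in> mc_chains V d 0 l" by (simp add: mc_chains_def)
    then show ?thesis using True by (auto simp: mh_boundaries_def mc_bd_def zero_fun_def)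
  next
    case False
    then have "mc_chains V d (k + 1) l = {0}" using assms by (intro chains) auto
    then show ?thesis using zero by (simp add: mh_boundaries_def)
  qed
  ultimately show ?thesis using free_quotient_self[of "{0}"] by simp
qed

end

subsection \<open>Magnitude homology on the diagonal\<close>

context finite_metric
begin

definition edges :: "('a \<times> 'a) set" where
  "edges = {(x, y). x \<in> V \<and> y \<in> V \<and> d x y = 1}"

definition unique_midpoints :: bool where
  "unique_midpoints \<longleftrightarrow>
     (\<forall>x\<in>V. \<forall>v\<in>V. \<forall>z\<in>V. d x v = 1 \<longrightarrow> d v z = 1 \<longrightarrow> x \<noteq> z \<longrightarrow> between x z = {v})"

definition backtracking_walks :: "nat \<Rightarrow> 'a list set" where
  "backtracking_walks k =
     {xs \<in> generators k k. \<forall>i. Suc (Suc i) < length xs \<longrightarrow> xs ! Suc (Suc i) = xs ! i}"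

lemma Cons_Cons_generators_diagonal_iff:
  "x # y # t \<in> generators (Suc k) (Suc k) \<longleftrightarrow> x \<in> V \<and> d x y = 1 \<and> y # t \<in> generators k k"
proof -
  have "d x y = 1"
    if "x \<in> V" "x \<noteq> y" "d x y \<le> Suc k" and t: "y # t \<in> generators k (Suc k - d x y)"
  proof -
    have "y \<in> V" using t by (rule Cons_generatorsD)
    then have "0 < d x y" using that d_eq_0_iff[of x y] by simp
    moreover have "k \<le> Suc k - d x y" using generators_empty[of "Suc k - d x y" k] t by fastforce
    ultimately show ?thesis using that by linarith
  qed
  moreover have "x \<noteq> y" if "x \<in> V" "d x y = 1" using that d_eq_0_iff[of x x] by auto
  ultimately show ?thesis by (auto simp: Cons_Cons_generators_iff)
qed

lemma generators_diagonal_nth: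
  "xs \<in> generators k k \<Longrightarrow> i < k \<Longrightarrow> d (xs ! i) (xs ! Suc i) = 1"
proof (induction k arbitrary: xs i)
  case (Suc k)
  obtain x y t where xs: "xs = x # y # t" using Suc.prems(1) by (rule generators_SucE)
  show ?case
    using Suc.prems Suc.IH[of "y # t"] unfolding xs Cons_Cons_generators_diagonal_iff
    by (cases i) simp_all
qed simp

lemma insertion_position_diagonal:
  assumes ins: "insert_at j v ys \<in> generators k k" and "j \<le> length ys"
    and gap: "Suc i < length ys" "d (ys ! i) (ys ! Suc i) \<noteq> 1"
  shows "j = Suc i"
proof (rule ccontr)
  assume "j \<noteq> Suc i"
  have k: "k = length ys" using ins by (simp add: generators_def)
  show False
  proof (cases "j \<le> i")
    case True
    then show False
      using generators_diagonal_nth[OF ins, of "Suc i"] assms(2) gap k by (simp add: nth_insert_at)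
  next
    case False
    then show False using generators_diagonal_nth[OF ins, of i] assms(2) gap k \<open>j \<noteq> Suc i\<close>
      by (simp add: nth_insert_at)
  qed
qed

lemma backtracking_walks_0: "backtracking_walks 0 = (\<lambda>x. [x]) ` V"
  by (auto simp: backtracking_walks_def generators_0_iff)

lemma backtracking_walks_1: "backtracking_walks (Suc 0) = (\<lambda>(x, y). [x, y]) ` edges"
proof -
  have "xs \<in> generators (Suc 0) (Suc 0) \<longleftrightarrow> (\<exists>x y. xs = [x, y] \<and> (x, y) \<in> edges)" for xs
    by (cases xs rule: remdups_adj.cases)
      (auto simp: Cons_Cons_generators_diagonal_iff generators_0_iff edges_def,
       auto simp: generators_def)
  then show ?thesis by (auto simp: backtracking_walks_def)
qed

lemma Cons_backtracking_walks_iff: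
  "x # y # z # t \<in> backtracking_walks (Suc (Suc k)) \<longleftrightarrow>
    x = z \<and> y # z # t \<in> backtracking_walks (Suc k)"
proof -
  let ?backtracks = "\<lambda>xs. \<forall>i. Suc (Suc i) < length xs \<longrightarrow> xs ! Suc (Suc i) = xs ! i"
  have "?backtracks (x # y # z # t) \<longleftrightarrow> x = z \<and> ?backtracks (y # z # t)"
    by (auto simp: nth_Cons split: nat.split)
  moreover have "x # y # z # t \<in> generators (Suc (Suc k)) (Suc (Suc k)) \<longleftrightarrow>
      y # z # t \<in> generators (Suc k) (Suc k)" if "x = z"
    using that d_commute[of y z]
    by (auto simp: Cons_Cons_generators_diagonal_iff dest: Cons_generatorsD)
  ultimately show ?thesis by (auto simp: backtracking_walks_def)
qed

lemma bij_betw_tl_backtracking_walks: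
  "bij_betw tl (backtracking_walks (Suc (Suc k))) (backtracking_walks (Suc k))"
proof -
  have shape: "\<exists>x y t. xs = x # y # x # t \<and> y # x # t \<in> backtracking_walks (Suc k)"
    if "xs \<in> backtracking_walks (Suc (Suc k))" for xs
  proof -
    have "length xs = Suc (Suc (Suc k))"
      using that by (simp add: backtracking_walks_def generators_def)
    then obtain x y z t where "xs = x # y # z # t" by (auto simp: length_Suc_conv)
    then show ?thesis using that by (simp add: Cons_backtracking_walks_iff)
  qed
  have prepend: "xs ! 1 # xs \<in> backtracking_walks (Suc (Suc k))"
    if "xs \<in> backtracking_walks (Suc k)" for xs
  proof -
    have "xs \<in> generators (Suc k) (Suc k)" using that by (simp add: backtracking_walks_def)
    then obtain y z t where "xs = y # z # t" by (rule generators_SucE)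
    then show ?thesis using that by (simp add: Cons_backtracking_walks_iff)
  qed
  show ?thesis
    by (rule bij_betw_byWitness[where f' = "\<lambda>xs. xs ! 1 # xs"]) (use shape prepend in fastforce)+
qed

lemma bd_del_at_diagonal:
  assumes c: "c \<in> chains k k" and xs: "xs \<in> generators k k" and i: "Suc (Suc i) < length xs"
    and mid: "between (xs ! i) (xs ! Suc (Suc i)) = {xs ! Suc i}"
  shows "bd c (del_at (Suc i) xs) = (-1) ^ Suc i * c xs"
proof -
  define ys where "ys = del_at (Suc i) xs"
  have ys: "length ys = k" "ys ! i = xs ! i" "ys ! Suc i = xs ! Suc (Suc i)"
    using xs i by (auto simp: ys_def del_at_def generators_def nth_append)
  have ins: "insert_at (Suc i) (xs ! Suc i) ys = xs" using i by (simp add: ys_def insert_at_del_at)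
  have "d (xs ! i) (xs ! Suc i) = 1" "d (xs ! Suc i) (xs ! Suc (Suc i)) = 1"
    using generators_diagonal_nth[OF xs] xs i by (auto simp: generators_def)
  then have "d (xs ! i) (xs ! Suc (Suc i)) = 2"
    using betweenD(7)[of "xs ! Suc i" "xs ! i" "xs ! Suc (Suc i)"] mid by simp
  then have gap: "d (ys ! i) (ys ! Suc i) \<noteq> 1" using ys by simp
  have "c (insert_at j w ys) = 0" if j: "j \<in> {1..<k} - {Suc i}" for j w
  proof -
    have "insert_at j w ys \<notin> generators k k"
      using insertion_position_diagonal[of j w ys k i] gap ys(1) i xs j
      by (auto simp: generators_def)
    then show ?thesis using c by (simp add: chains_def supported_on_eq_0)
  qed
  then have "bd c ys = (\<Sum>j\<in>{Suc i}.
      (-1) ^ j * (\<Sum>v\<in>between (ys ! (j - 1)) (ys ! j). c (insert_at j v ys)))"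
    unfolding bd_def using i xs ys(1)
    by (intro sum.mono_neutral_right) (auto simp: generators_def)
  also have "\<dots> = (-1) ^ Suc i * c xs" using ys(2,3) mid ins by simp
  finally show ?thesis by (simp only: ys_def)
qed

lemma backtracking_walks_if_cycle:
  assumes "unique_midpoints" and c: "c \<in> chains k k" "bd c = 0" "c xs \<noteq> 0"
  shows "xs \<in> backtracking_walks k"
proof -
  have xs: "xs \<in> generators k k" using supported_onD[OF c(1)[unfolded chains_def] c(3)] .
  have "xs ! Suc (Suc i) = xs ! i" if i: "Suc (Suc i) < length xs" for i
  proof (rule ccontr)
    assume "xs ! Suc (Suc i) \<noteq> xs ! i"
    moreover have "{xs ! i, xs ! Suc i, xs ! Suc (Suc i)} \<subseteq> V"
      using xs i by (auto simp: generators_def)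
    moreover have "d (xs ! i) (xs ! Suc i) = 1" "d (xs ! Suc i) (xs ! Suc (Suc i)) = 1"
      using generators_diagonal_nth[OF xs] xs i by (auto simp: generators_def)
    ultimately have "between (xs ! i) (xs ! Suc (Suc i)) = {xs ! Suc i}"
      using \<open>unique_midpoints\<close> unfolding unique_midpoints_def by auto
    then show False using bd_del_at_diagonal[OF c(1) xs i] c(2,3) by simp
  qed
  then show ?thesis using xs by (simp add: backtracking_walks_def)
qed

lemma bd_backtracking:
  assumes "c \<in> supported_on (backtracking_walks k)"
  shows "bd c = 0"
proof (rule ext, rule ccontr)
  fix ys assume "bd c ys \<noteq> 0 ys"
  then obtain i v where i: "0 < i" "i < length ys" "v \<in> between (ys ! (i - 1)) (ys ! i)"
      "c (insert_at i v ys) \<noteq> 0"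
    by (auto elim: bd_nonzeroE)
  then have "insert_at i v ys \<in> backtracking_walks k" using supported_onD[OF assms] by blast
  moreover obtain j where j: "i = Suc j" using i(1) by (cases i) auto
  ultimately have "insert_at i v ys ! Suc (Suc j) = insert_at i v ys ! j"
    using i(2) by (simp add: backtracking_walks_def)
  then have "ys ! i = ys ! (i - 1)" using i(2) j by (simp add: nth_insert_at)
  then show False using i(3) by simp
qed

theorem free_homology_diagonal:
  assumes "unique_midpoints"
  shows "free_homology chains k k (backtracking_walks k)"
proof -
  have "cycles chains k k = supported_on (backtracking_walks k)"
  proof
    show "cycles chains k k \<subseteq> supported_on (backtracking_walks k)"
      using backtracking_walks_if_cycle[OF assms] by (auto simp: supported_on_def)
    have "supported_on (backtracking_walks k) \<subseteq> chains k k"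
      unfolding chains_def by (rule supported_on_mono) (auto simp: backtracking_walks_def)
    then show "supported_on (backtracking_walks k) \<subseteq> cycles chains k k"
      using bd_backtracking by blast
  qed
  moreover have "boundaries chains k k = {0}" by (simp add: chains_trivial bd.zero)
  ultimately show ?thesis by (simp add: free_homology_def free_quotient_supported_on)
qed

lemma finite_backtracking_walks: "finite (backtracking_walks k)"
  using finite_generators by (rule finite_subset[rotated]) (auto simp: backtracking_walks_def)

lemma card_backtracking_walks:
  "card (backtracking_walks k) = (if k = 0 then card V else card edges)"
proof (cases k)
  case 0
  then show ?thesis by (simp add: backtracking_walks_0 card_image inj_on_def)
next
  case (Suc j)
  have "card (backtracking_walks (Suc j)) = card edges"
  proof (induction j)
    case 0
    have "inj_on (\<lambda>(x, y). [x, y]) edges" by (auto simp: inj_on_def)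
    then show ?case by (simp add: backtracking_walks_1 card_image)
  next
    case (Suc j)
    then show ?case using bij_betw_same_card[OF bij_betw_tl_backtracking_walks[of j]] by simp
  qed
  then show ?thesis using Suc by simp
qed

end

subsection \<open>The recursion for the ranks\<close>

declare T_fun.simps [simp del]

lemma T_fun_negative: "k < 0 \<or> l < 0 \<Longrightarrow> T_fun m k l = 0"
  by (simp add: T_fun.simps)

lemma T_fun_nonneg: "0 \<le> m \<Longrightarrow> 0 \<le> T_fun m k l"
  by (induction m k l rule: T_fun.induct) (subst T_fun.simps, auto simp: le_max_iff_disj)

lemma T_fun_diagonal_step: "0 \<le> m \<Longrightarrow> T_fun m (k - 1) (l - 1) \<le> T_fun m k l"
  using T_fun.simps[of m k l] T_fun.simps[of m "k - 1" "l - 1"] T_fun_nonneg[of m]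
  by (auto split: if_splits)

lemma T_fun_below_diagonal: "2 \<le> m \<Longrightarrow> l < k \<Longrightarrow> T_fun m k l = 0"
  by (induction m k l rule: T_fun.induct) (subst T_fun.simps, auto)

lemma T_fun_on_diagonal:
  assumes "3 \<le> m"
  shows "T_fun m (int k) (int k) = (if k = 0 then 2 * m else 4 * m)"
proof (induction k)
  case 0
  then show ?case by (simp add: T_fun.simps)
next
  case (Suc k)
  have "T_fun m (int (Suc k) - 2) (int (Suc k) - m) = 0"
    using assms by (intro T_fun_below_diagonal) auto
  then show ?case using Suc assms by (auto simp: T_fun.simps[of m "1 + int k" "1 + int k"])
qed

lemma T_fun_above_diagonal:
  "0 \<le> m \<Longrightarrow> 0 \<le> k \<Longrightarrow> k < l \<Longrightarrow> T_fun m k l = T_fun m (k - 2) (l - m)"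
proof (induction m k l rule: T_fun.induct)
  case (1 m k l)
  have "T_fun m (k - 1) (l - 1) \<le> T_fun m (k - 2) (l - m)"
  proof (cases "k = 0")
    case True
    then show ?thesis using 1 by (simp add: T_fun_negative T_fun_nonneg)
  next
    case False
    then have "T_fun m (k - 1) (l - 1) = T_fun m (k - 2 - 1) (l - m - 1)"
      using 1 by (simp add: algebra_simps)
    also have "\<dots> \<le> T_fun m (k - 2) (l - m)" using 1(3) by (rule T_fun_diagonal_step)
    finally show ?thesis .
  qed
  then show ?case using 1 by (simp add: T_fun.simps[of m k l])
qed

lemma T_fun_vanishing:
  assumes "2 \<le> m" "0 \<le> k" "l < k \<or> k < l \<and> (k \<le> 1 \<or> l < m)"
  shows "T_fun m k l = 0"
  using assms T_fun_below_diagonal[of m l k] T_fun_above_diagonal[of m k l]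
  by (auto simp: T_fun_negative)

subsection \<open>Arcs on an even cycle\<close>

text \<open>Here \<open>arc x y\<close> is the number of steps from \<open>x\<close> to \<open>y\<close> in one fixed direction round a cycle of
  length \<open>2 * m\<close>; swapping its arguments reverses the direction.\<close>

locale even_cycle =
  fixes V :: "'a set" and d :: "'a \<Rightarrow> 'a \<Rightarrow> nat" and m :: nat and arc :: "'a \<Rightarrow> 'a \<Rightarrow> nat"
  assumes m_ge_2: "2 \<le> m"
    and finite_vertices: "finite V"
    and vertices_nonempty: "V \<noteq> {}"
    and arc_less: "x \<in> V \<Longrightarrow> y \<in> V \<Longrightarrow> arc x y < 2 * m"
    and arc_eq_0_iff: "x \<in> V \<Longrightarrow> y \<in> V \<Longrightarrow> arc x y = 0 \<longleftrightarrow> x = y"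
    and arc_add: "x \<in> V \<Longrightarrow> y \<in> V \<Longrightarrow> z \<in> V \<Longrightarrow>
      arc x y + arc y z = arc x z \<or> arc x y + arc y z = arc x z + 2 * m"
    and ex_arc_from: "x \<in> V \<Longrightarrow> j < 2 * m \<Longrightarrow> \<exists>y\<in>V. arc x y = j"
    and d_eq_min_arc: "x \<in> V \<Longrightarrow> y \<in> V \<Longrightarrow> d x y = min (arc x y) (arc y x)"
begin

lemma arc_self [simp]: "x \<in> V \<Longrightarrow> arc x x = 0"
  by (simp add: arc_eq_0_iff)

lemma arc_swap: "x \<in> V \<Longrightarrow> y \<in> V \<Longrightarrow> x \<noteq> y \<Longrightarrow> arc x y + arc y x = 2 * m"
  using arc_add[of x y x] arc_eq_0_iff[of x y] by auto

lemma d_eq_arc: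
  "x \<in> V \<Longrightarrow> y \<in> V \<Longrightarrow> d x y = (if arc x y \<le> m then arc x y else 2 * m - arc x y)"
  using arc_swap[of x y] d_eq_min_arc[of x y] by (cases "x = y") auto

lemma arc_inject: "x \<in> V \<Longrightarrow> y \<in> V \<Longrightarrow> z \<in> V \<Longrightarrow> arc x y = arc x z \<longleftrightarrow> y = z"
  using arc_add[of x y z] arc_less[of y z] arc_eq_0_iff[of y z] by auto

lemma ex_arc_to:
  assumes "x \<in> V" "j < 2 * m"
  shows "\<exists>y\<in>V. arc y x = j"
proof (cases "j = 0")
  case False
  then obtain y where y: "y \<in> V" "arc x y = 2 * m - j"
    using ex_arc_from[of x "2 * m - j"] assms by auto
  then have "x \<noteq> y" using assms by auto
  then have "arc y x = j" using arc_swap[of x y] y assms by simp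
  then show ?thesis using y(1) by blast
qed (use assms in \<open>auto intro!: bexI[of _ x]\<close>)

lemma even_cycle_reverse: "even_cycle V d m (\<lambda>x y. arc y x)"
proof
  fix x y z assume "x \<in> V" "y \<in> V" "z \<in> V"
  then show "arc y x + arc z y = arc z x \<or> arc y x + arc z y = arc z x + 2 * m"
    using arc_add[of z y x] by (simp add: add.commute)
qed (use m_ge_2 finite_vertices vertices_nonempty arc_less arc_eq_0_iff ex_arc_to d_eq_min_arc
    in \<open>auto simp: min.commute\<close>)

end

sublocale even_cycle \<subseteq> finite_metric V d
proof
  fix x y z assume V: "x \<in> V" "y \<in> V" "z \<in> V"
  have "arc x z + arc z x \<le> 2 * m" using V arc_swap[of x z] by (cases "x = z") auto
  then show "d x z \<le> d x y + d y z"
    using arc_add[OF V] arc_add[OF V(3,2,1)] arc_add[OF V(1,3,2)] arc_add[OF V(3,1,2)]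
    by (simp add: V d_eq_min_arc) linarith
qed (use finite_vertices arc_eq_0_iff in \<open>auto simp: d_eq_min_arc min_def\<close>)

sublocale even_cycle \<subseteq> rev: even_cycle V d m "\<lambda>x y. arc y x"
  by (rule even_cycle_reverse)

context even_cycle
begin

lemma between_iff_arc:
  assumes V: "x \<in> V" "v \<in> V" "z \<in> V" and "arc x v \<le> m \<or> arc x z < m"
  shows "v \<in> between x z \<longleftrightarrow> 0 < arc x v \<and> arc x v < arc x z \<and> arc x z \<le> m"
proof -
  have "arc x v < 2 * m" "arc v z < 2 * m" "arc x z < 2 * m" using V arc_less by auto
  then show ?thesis
    using assms(4) arc_add[OF V]
    by (auto simp: between_iff[OF V] d_eq_arc[OF V(1,2)] d_eq_arc[OF V(2,3)] d_eq_arc[OF V(1,3)]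
        split: if_splits)
qed

lemma between_unit_step:
  assumes V: "x \<in> V" "y \<in> V" "z \<in> V" and xy: "arc x y = 1" and yz: "0 < arc y z" "arc y z < m"
  shows "{v \<in> between x z. arc x v \<le> m} = insert y (between y z)"
    and "v \<in> between y z \<Longrightarrow> 2 \<le> arc x v \<and> arc x v \<le> m"
proof -
  have xz: "arc x z = Suc (arc y z)" using arc_add[OF V] arc_less[OF V(1,3)] xy yz by auto
  have xv: "arc x v = Suc (arc y v) \<or> arc x v = 0 \<and> Suc (arc y v) = 2 * m" if "v \<in> V" for v
    using arc_add[OF V(1,2) that] arc_less[OF V(2) that] xy by auto
  have yz_iff: "v \<in> between y z \<longleftrightarrow> v \<in> V \<and> 0 < arc y v \<and> arc y v < arc y z" for v
    using between_iff_arc[OF V(2) _ V(3)] yz by (auto dest: betweenD)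
  have xz_iff: "v \<in> between x z \<and> arc x v \<le> m \<longleftrightarrow> v \<in> V \<and> 0 < arc x v \<and> arc x v < arc x z" for v
    using between_iff_arc[OF V(1) _ V(3)] xz yz by (auto dest: betweenD)
  have "v \<in> between x z \<and> arc x v \<le> m \<longleftrightarrow> v = y \<or> v \<in> between y z" for v
  proof (cases "v \<in> V")
    case True
    then show ?thesis
      using xv[OF True] arc_eq_0_iff[OF V(2) True] yz xz unfolding xz_iff yz_iff by auto
  qed (use V(2) in \<open>auto dest: betweenD\<close>)
  then show "{v \<in> between x z. arc x v \<le> m} = insert y (between y z)" by auto
  show "2 \<le> arc x v \<and> arc x v \<le> m" if "v \<in> between y z"
    using that xv[of v] yz unfolding yz_iff by auto
qed

fun first_arc :: "'a list \<Rightarrow> nat" where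
  "first_arc (x # y # t) = arc x y"
| "first_arc _ = 0"

definition half_chains :: "nat \<Rightarrow> nat \<Rightarrow> ('a list \<Rightarrow> int) set" where
  "half_chains k l = supported_on {xs \<in> generators k l. first_arc xs \<le> m}"

lemma half_chains_subset_chains: "half_chains k l \<subseteq> chains k l"
  unfolding half_chains_def chains_def by (rule supported_on_mono) auto

lemma half_chains_eq_0: "c \<in> half_chains k l \<Longrightarrow> \<not> arc x y \<le> m \<Longrightarrow> c (x # y # t) = 0"
  using supported_on_eq_0[of c _ "x # y # t"] by (simp add: half_chains_def)

lemma half_chains_zero [simp]: "0 \<in> half_chains k l"
  by (simp add: half_chains_def)

lemma half_chains_diff: "c \<in> half_chains k l \<Longrightarrow> e \<in> half_chains k l \<Longrightarrow> c - e \<in> half_chains k l"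
  by (simp add: half_chains_def supported_on_diff)

lemma half_chains_add: "c \<in> half_chains k l \<Longrightarrow> e \<in> half_chains k l \<Longrightarrow> c + e \<in> half_chains k l"
  by (simp add: half_chains_def supported_on_add)

lemma bd_half_chains:
  assumes "c \<in> half_chains (Suc k) l"
  shows "bd c \<in> half_chains k l"
proof -
  have "ys \<in> generators k l \<and> first_arc ys \<le> m" if nz: "bd c ys \<noteq> 0" for ys
  proof -
    obtain i v where i: "0 < i" "i < length ys" "v \<in> between (ys ! (i - 1)) (ys ! i)"
        "c (insert_at i v ys) \<noteq> 0"
      using nz by (rule bd_nonzeroE)
    then have ins: "insert_at i v ys \<in> generators (Suc k) l" "first_arc (insert_at i v ys) \<le> m"
      using supported_onD[OF assms[unfolded half_chains_def]] by auto
    obtain x y t where ys: "ys = x # y # t" using i(1,2) by (cases ys rule: remdups_adj.cases) auto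
    have "arc x y \<le> m"
    proof (cases "i = 1")
      case True
      then have v: "v \<in> between x y" "arc x v \<le> m"
        using i(3) ins(2) ys by (simp_all add: insert_at_def)
      then show ?thesis using between_iff_arc[of x v y] betweenD[OF v(1)] by simp
    next
      case False
      then have "i = Suc (Suc (i - 2))" using i(1) by simp
      then obtain j where "i = Suc (Suc j)" by blast
      then show ?thesis using ins(2) ys by simp
    qed
    then show ?thesis using ins(1) i(1-3) insert_at_generators_iff ys by simp
  qed
  then show ?thesis by (auto simp: half_chains_def supported_on_def)
qed

subsection \<open>Prepending and dropping the first vertex\<close>

definition step_chains :: "nat \<Rightarrow> nat \<Rightarrow> nat \<Rightarrow> ('a list \<Rightarrow> int) set" where
  "step_chains j k l = supported_on {xs \<in> generators k l. first_arc xs = j}"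

fun prepend :: "nat \<Rightarrow> ('a list \<Rightarrow> int) \<Rightarrow> 'a list \<Rightarrow> int" where
  "prepend j g (x # y # t) = (if x \<in> V \<and> arc x y = j then g (y # t) else 0)"
| "prepend j g _ = 0"

definition drop_first :: "('a list \<Rightarrow> int) \<Rightarrow> 'a list \<Rightarrow> int" where
  "drop_first c xs = (\<Sum>x\<in>V. c (x # xs))"

lemma additive_prepend: "additive (prepend j)"
proof (standard, rule ext)
  show "prepend j (g + h) xs = (prepend j g + prepend j h) xs" for g h xs
    by (cases xs rule: remdups_adj.cases) simp_all
qed

lemma additive_drop_first: "additive drop_first"
  by standard (simp add: fun_eq_iff drop_first_def sum.distrib)

lemma Cons_Cons_step_generators_iff:
  assumes "0 < j" "j \<le> m"
  shows "x # y # t \<in> generators (Suc k) l \<and> arc x y = j \<longleftrightarrow>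
    x \<in> V \<and> arc x y = j \<and> j \<le> l \<and> y # t \<in> generators k (l - j)"
proof -
  have "x \<noteq> y \<and> d x y = j" if "x \<in> V" "y \<in> V" "arc x y = j"
    using that assms d_eq_arc by auto
  then show ?thesis
    by (cases "y \<in> V") (auto simp: Cons_Cons_generators_iff dest: Cons_generatorsD)
qed

lemma prepend_step_chains:
  assumes "0 < j" "j \<le> m" "g \<in> chains k l"
  shows "prepend j g \<in> step_chains j (Suc k) (l + j)"
proof -
  have "xs \<in> generators (Suc k) (l + j) \<and> first_arc xs = j" if nz: "prepend j g xs \<noteq> 0" for xs
  proof -
    obtain x y t where xs: "xs = x # y # t" using nz by (cases xs rule: remdups_adj.cases) auto
    then have "x \<in> V" "arc x y = j" "g (y # t) \<noteq> 0" using nz by (auto split: if_splits)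
    then show ?thesis
      using Cons_Cons_step_generators_iff[OF assms(1,2), of x y t k "l + j"] supported_onD[of g]
        assms(3) xs
      by (auto simp: chains_def)
  qed
  then show ?thesis by (auto simp: step_chains_def supported_on_def)
qed

lemma drop_first_chains:
  assumes "0 < j" "j \<le> m" "c \<in> step_chains j (Suc k) l"
  shows "drop_first c \<in> chains k (l - j)"
proof -
  have "xs \<in> generators k (l - j)" if nz: "drop_first c xs \<noteq> 0" for xs
  proof -
    obtain x where "c (x # xs) \<noteq> 0" using nz unfolding drop_first_def by (meson sum.neutral)
    then have gen: "x # xs \<in> generators (Suc k) l" "first_arc (x # xs) = j"
      using supported_onD[OF assms(3)[unfolded step_chains_def]] by blast+
    obtain y t where "xs = y # t" using generators_SucE[OF gen(1)] by blast
    then show ?thesis using Cons_Cons_step_generators_iff[OF assms(1,2), of x y t k l] gen by auto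
  qed
  then show ?thesis by (auto simp: chains_def supported_on_def)
qed

lemma prepend_drop_first:
  assumes c: "c \<in> step_chains j (Suc k) l"
  shows "prepend j (drop_first c) = c"
proof
  fix xs
  note supp = supported_onD[OF c[unfolded step_chains_def]]
  show "prepend j (drop_first c) xs = c xs"
  proof (cases xs rule: remdups_adj.cases)
    case (3 x y t)
    show ?thesis
    proof (cases "x \<in> V \<and> y \<in> V \<and> arc x y = j")
      case True
      have "c (w # y # t) = 0" if "w \<in> V - {x}" for w
      proof (rule ccontr)
        assume "c (w # y # t) \<noteq> 0"
        then have "arc w y = arc x y" using supp True by fastforce
        then show False using rev.arc_inject[of y w x] that True by auto
      qed
      then have "drop_first c (y # t) = c (x # y # t)"
        using True finite_V by (simp add: drop_first_def sum.remove[of V x])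
      then show ?thesis using True 3 by simp
    next
      case False
      then have "c (x # y # t) = 0" and "y \<notin> V \<Longrightarrow> c (w # y # t) = 0" for w
        using supp by (fastforce simp: generators_def)+
      then show ?thesis using False 3 by (auto simp: drop_first_def)
    qed
  qed (use supp in \<open>fastforce simp: generators_def\<close>)+
qed

lemma drop_first_prepend:
  assumes "j < 2 * m" "g \<in> chains k l"
  shows "drop_first (prepend j g) = g"
proof
  fix xs
  note supp = supported_onD[OF assms(2)[unfolded chains_def]]
  show "drop_first (prepend j g) xs = g xs"
  proof (cases xs)
    case Nil
    then show ?thesis using supp[of "[]"] by (auto simp: drop_first_def generators_def)
  next
    case (Cons y t)
    show ?thesis
    proof (cases "y \<in> V")
      case True
      then obtain x where x: "x \<in> V" "arc x y = j" using ex_arc_to assms(1) by blast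
      then have "arc w y = j \<longleftrightarrow> w = x" if "w \<in> V" for w
        using rev.arc_inject[OF True that x(1)] by simp
      then have "drop_first (prepend j g) xs = (\<Sum>w\<in>V. if w = x then g (y # t) else 0)"
        unfolding drop_first_def Cons by (intro sum.cong refl) auto
      then show ?thesis using x finite_V Cons by simp
    next
      case False
      then have "g (y # t) = 0" using supp Cons_generatorsD by blast
      then show ?thesis by (simp add: drop_first_def Cons sum.neutral)
    qed
  qed
qed

lemma bd_prepend:
  assumes "\<And>x v y t. v \<in> between x y \<Longrightarrow> arc x v = j \<Longrightarrow> g (v # y # t) = 0"
  shows "bd (prepend j g) = - prepend j (bd g)"
proof
  fix xs
  show "bd (prepend j g) xs = (- prepend j (bd g)) xs"
  proof (cases xs rule: remdups_adj.cases)
    case (3 x y t)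
    have "bd (\<lambda>s. prepend j g (x # s)) (y # t)
        = bd (\<lambda>s. (if x \<in> V \<and> arc x y = j then 1 else 0) * g s) (y # t)"
      by (rule bd_cong) auto
    also have "\<dots> = prepend j (bd g) (x # y # t)"
      by (simp add: additive_scale[OF additive_bd])
    finally have "bd (\<lambda>s. prepend j g (x # s)) (y # t) = \<dots>" .
    moreover have "(\<Sum>v\<in>between x y. prepend j g (x # v # y # t)) = 0"
      using assms by (intro sum.neutral) auto
    ultimately show ?thesis by (simp only: 3 bd_Cons_Cons fun_Compl_def)
  qed simp_all
qed

end

(* Only after reopening the context are the new definitions available under the prefix rev. *)

context even_cycle
begin

subsection \<open>Acyclicity of the half complexes\<close>

fun homotopy :: "('a list \<Rightarrow> int) \<Rightarrow> 'a list \<Rightarrow> int" where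
  "homotopy c (x # y # z # r) =
     (if y \<in> V \<and> arc x y = 1 \<and> 2 \<le> arc x z \<and> arc x z \<le> m then - c (x # z # r) else 0)"
| "homotopy c _ = 0"

lemma homotopy_half_chains:
  assumes "c \<in> half_chains k l"
  shows "homotopy c \<in> half_chains (Suc k) l"
proof -
  have "xs \<in> generators (Suc k) l \<and> first_arc xs \<le> m" if nz: "homotopy c xs \<noteq> 0" for xs
  proof -
    obtain x y z r where xs: "xs = x # y # z # r"
      using nz by (cases "(c, xs)" rule: homotopy.cases) auto
    then have y: "y \<in> V" "arc x y = 1" and xz: "2 \<le> arc x z" "arc x z \<le> m" and "c (x # z # r) \<noteq> 0"
      using nz by (auto split: if_splits)
    then have gen: "x # z # r \<in> generators k l"
      using supported_onD[of c] assms by (auto simp: half_chains_def)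
    then have V: "x \<in> V" "z \<in> V" by (auto simp: generators_def)
    have "arc y z = arc x z - 1" using arc_add[of x y z] arc_less[of y z] V y xz by auto
    then have "d x y + d y z = d x z" "y \<noteq> z" "x \<noteq> y"
      using V y xz m_ge_2 by (auto simp: d_eq_arc)
    then show ?thesis using gen xs y m_ge_2 V by (auto simp: generators_def)
  qed
  then show ?thesis by (auto simp: half_chains_def supported_on_def)
qed

lemma bd_homotopy_long_step:
  assumes c: "c \<in> half_chains k l" and V: "x \<in> V" "y \<in> V" "x \<noteq> y" and "arc x y \<noteq> 1"
  shows "bd (homotopy c) (x # y # t) = c (x # y # t)"
proof -
  have "bd (\<lambda>s. homotopy c (x # s)) (y # t) = bd 0 (y # t)"
  proof (rule bd_cong)
    show "homotopy c (x # y # s) = 0 (y # s)" for s using assms(5) by (cases s) auto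
  qed
  then have bd: "bd (homotopy c) (x # y # t) = - (\<Sum>v\<in>between x y. homotopy c (x # v # y # t))"
    by (simp add: bd.zero)
  show ?thesis
  proof (cases "arc x y \<le> m")
    case True
    have far: "2 \<le> arc x y" using assms(5) arc_eq_0_iff[OF V(1,2)] V(3) by linarith
    obtain p where p: "p \<in> V" "arc x p = 1" using ex_arc_from[of x 1] V m_ge_2 by auto
    have "p \<in> between x y" using between_iff_arc[of x p y] p V far True m_ge_2 by simp
    moreover have "homotopy c (x # v # y # t) = 0" if "v \<in> between x y - {p}" for v
      using that p V arc_inject[of x v p] by (auto dest: betweenD)
    ultimately have "(\<Sum>v\<in>between x y. homotopy c (x # v # y # t)) = homotopy c (x # p # y # t)"
      by (simp add: sum.remove[of _ p])
    then show ?thesis using bd p far True by simp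
  next
    case False
    then show ?thesis using bd half_chains_eq_0[OF c] by simp
  qed
qed

lemma bd_homotopy_unit_step:
  assumes c: "c \<in> half_chains k l" and V: "x \<in> V" "y \<in> V" "z \<in> V"
    and xy: "arc x y = 1" and yz: "0 < arc y z" "arc y z < m"
  shows "bd (homotopy c) (x # y # z # r) = c (x # y # z # r) + bd c (x # z # r)"
proof -
  have xz: "arc x z = Suc (arc y z)" using arc_add[OF V] arc_less[OF V(1,3)] xy yz by auto
  have "v \<notin> between x y" for v
    using between_iff_arc[of x v y] betweenD(1)[of v x y] V xy m_ge_2 by auto
  then have "between x y = {}" by blast
  moreover have "bd (\<lambda>s. homotopy c (x # y # s)) (z # r) = bd (- (\<lambda>s. c (x # s))) (z # r)"
    by (rule bd_cong) (use V xy xz yz in auto)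
  then have "bd (\<lambda>s. homotopy c (x # y # s)) (z # r)
      = bd c (x # z # r) + (\<Sum>v\<in>between x z. c (x # v # z # r))"
    by (simp add: bd.minus)
  moreover have "(\<Sum>v\<in>between x z. c (x # v # z # r))
      = c (x # y # z # r) + (\<Sum>v\<in>between y z. c (x # v # z # r))"
  proof -
    have "(\<Sum>v\<in>between x z. c (x # v # z # r))
        = (\<Sum>v\<in>{v \<in> between x z. arc x v \<le> m}. c (x # v # z # r))"
      using half_chains_eq_0[OF c] by (intro sum.mono_neutral_right) auto
    also have "{v \<in> between x z. arc x v \<le> m} = insert y (between y z)"
      by (rule between_unit_step(1)[OF V xy yz])
    finally show ?thesis by (subst (asm) sum.insert) (auto dest: betweenD)
  qed
  moreover have "(\<Sum>v\<in>between y z. homotopy c (x # y # v # z # r))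
      = - (\<Sum>v\<in>between y z. c (x # v # z # r))"
    unfolding sum_negf[symmetric] using between_unit_step(2)[OF V xy yz] V(2) xy
    by (intro sum.cong) auto
  ultimately show ?thesis by simp
qed

lemma homotopy_retraction:
  assumes c: "c \<in> half_chains (Suc k) l" and cycle: "bd c = 0"
  defines "p \<equiv> c - bd (homotopy c)"
  shows "p \<in> step_chains 1 (Suc k) l" and "drop_first p \<in> rev.half_chains k (l - 1)"
proof -
  have p_chain: "p \<in> chains (Suc k) l"
    unfolding p_def using c homotopy_half_chains half_chains_subset_chains
    by (blast intro: chains_diff bd_chains)
  have unit: "arc x y = 1" if nz: "p (x # y # t) \<noteq> 0" for x y t
    using bd_homotopy_long_step[OF c chains_nonzero_Cons_Cons[OF p_chain nz]] nz
    by (fastforce simp: p_def)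
  have "xs \<in> generators (Suc k) l \<and> first_arc xs = 1" if nz: "p xs \<noteq> 0" for xs
  proof -
    have "xs \<in> generators (Suc k) l" using supported_onD[OF p_chain[unfolded chains_def] nz] .
    then show ?thesis using nz by (metis generators_SucE first_arc.simps(1) unit)
  qed
  then show step: "p \<in> step_chains 1 (Suc k) l" by (simp add: step_chains_def supported_on_def)
  have short: "arc z y \<le> m" if nz: "p (x # y # z # r) \<noteq> 0" for x y z r
  proof (rule ccontr)
    assume gt: "\<not> arc z y \<le> m"
    have V: "x \<in> V" "y \<in> V" "z \<in> V" "y \<noteq> z"
      using supported_onD[OF p_chain[unfolded chains_def] nz] by (auto simp: generators_def)
    have "0 < arc y z" "arc y z < m" using arc_swap[of y z] arc_eq_0_iff[of y z] gt V by auto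
    then have "p (x # y # z # r) = - bd c (x # z # r)"
      using bd_homotopy_unit_step[OF c V(1-3) unit[OF nz]] by (simp add: p_def)
    then show False using nz cycle by simp
  qed
  have "rev.first_arc ys \<le> m" if nz: "drop_first p ys \<noteq> 0" for ys
  proof -
    obtain x where "p (x # ys) \<noteq> 0" using nz unfolding drop_first_def by (meson sum.neutral)
    then show ?thesis using short
      by (cases ys rule: rev.first_arc.cases) auto
  qed
  then show "drop_first p \<in> rev.half_chains k (l - 1)"
    using drop_first_chains[OF _ _ step] m_ge_2
    by (auto simp: rev.half_chains_def chains_def supported_on_def)
qed

lemma bd_prepend_unit:
  assumes "e \<in> rev.half_chains k l"
  shows "bd (prepend 1 e) = - prepend 1 (bd e)"
proof (rule bd_prepend)
  fix x v y t assume v: "v \<in> between x y" "arc x v = 1"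
  note V = betweenD(1-5)[OF v(1)]
  have "arc x y \<le> m" "1 < arc x y" using between_iff_arc[of x v y] V v m_ge_2 by auto
  moreover have "arc y v + arc v y = 2 * m" using arc_swap[of y v] V by auto
  ultimately have "\<not> arc y v \<le> m" using arc_add[of x v y] V v(2) by auto
  then show "e (v # y # t) = 0" by (rule rev.half_chains_eq_0[OF assms])
qed

lemma half_chains_exact_0:
  assumes "0 < l" shows "exact_at half_chains 0 l"
proof -
  have "half_chains 0 l \<subseteq> {bd 0}"
    using assms half_chains_subset_chains[of 0 l] by (simp add: chains_0_trivial bd.zero)
  then show ?thesis using half_chains_zero by (auto simp: exact_at_def)
qed

lemma half_chains_exact_Suc:
  assumes "0 < l" and IH: "exact_at rev.half_chains k (l - 1)"
  shows "exact_at half_chains (Suc k) l"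
  unfolding exact_at_def
proof
  fix c assume "c \<in> cycles half_chains (Suc k) l"
  then have c: "c \<in> half_chains (Suc k) l" "bd c = 0" by simp_all
  define p where "p = c - bd (homotopy c)"
  define g where "g = drop_first p"
  note retraction = homotopy_retraction[OF c, folded p_def]
  have g: "g \<in> rev.half_chains k (l - 1)" unfolding g_def by (rule retraction(2))
  have prepend_g: "prepend 1 g = p" unfolding g_def by (rule prepend_drop_first[OF retraction(1)])
  have "bd g \<in> chains (k - 1) (l - 1)"
    using g rev.half_chains_subset_chains bd_chains_pred by blast
  then have "bd g = drop_first (prepend 1 (bd g))"
    using m_ge_2 by (simp add: drop_first_prepend)
  also have "prepend 1 (bd g) = - bd p"
    using bd_prepend_unit[OF g] prepend_g by simp
  also have "\<dots> = 0" by (simp add: p_def bd.diff bd_bd c(2))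
  finally have "bd g = 0" by (simp only: additive.zero[OF additive_drop_first])
  then obtain g' where g': "g' \<in> rev.half_chains (Suc k) (l - 1)" "bd g' = g"
    using exact_atE[OF IH g] by blast
  have "prepend 1 g' \<in> step_chains 1 (Suc (Suc k)) l"
    using prepend_step_chains[of 1 g' "Suc k" "l - 1"] g'(1) rev.half_chains_subset_chains m_ge_2
      assms(1) by auto
  also have "\<dots> \<subseteq> half_chains (Suc (Suc k)) l"
    unfolding step_chains_def half_chains_def using m_ge_2 by (intro supported_on_mono) auto
  finally have "homotopy c - prepend 1 g' \<in> half_chains (Suc (Suc k)) l"
    using homotopy_half_chains[OF c(1)] by (simp add: half_chains_def supported_on_diff)
  moreover have "bd (homotopy c - prepend 1 g') = c"
    unfolding bd.diff bd_prepend_unit[OF g'(1)] g'(2) prepend_g by (simp add: p_def)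
  ultimately show "c \<in> boundaries half_chains (Suc k) l" by (metis image_eqI)
qed

end

context even_cycle
begin

theorem half_chains_exact: "k < l \<Longrightarrow> exact_at half_chains k l \<and> exact_at rev.half_chains k l"
proof (induction k arbitrary: l)
  case 0
  then show ?case by (simp add: half_chains_exact_0 rev.half_chains_exact_0)
next
  case (Suc k)
  then have "exact_at half_chains k (l - 1)" "exact_at rev.half_chains k (l - 1)" by simp_all
  then show ?case using Suc.prems half_chains_exact_Suc rev.half_chains_exact_Suc by simp
qed

subsection \<open>The Mayer--Vietoris sequence of the two half complexes\<close>

definition antipodal_chains :: "nat \<Rightarrow> nat \<Rightarrow> ('a list \<Rightarrow> int) set" where
  "antipodal_chains k l = half_chains k l \<inter> rev.half_chains k l"

lemma antipodal_chains_Suc: "antipodal_chains (Suc k) l = step_chains m (Suc k) l"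
proof -
  have "first_arc xs \<le> m \<and> rev.first_arc xs \<le> m \<longleftrightarrow> first_arc xs = m"
    if gen: "xs \<in> generators (Suc k) l" for xs
  proof -
    obtain x y t where xs: "xs = x # y # t" using gen by (rule generators_SucE)
    then have "arc x y + arc y x = 2 * m" using gen arc_swap by (simp add: generators_def)
    then show ?thesis using xs by auto
  qed
  then have "{xs \<in> generators (Suc k) l. first_arc xs \<le> m}
        \<inter> {xs \<in> generators (Suc k) l. rev.first_arc xs \<le> m}
      = {xs \<in> generators (Suc k) l. first_arc xs = m}"
    by blast
  then show ?thesis
    by (simp add: antipodal_chains_def step_chains_def half_chains_def rev.half_chains_def
        flip: supported_on_Int)
qed

lemma bd_antipodal_chains: "c \<in> antipodal_chains (Suc k) l \<Longrightarrow> bd c \<in> antipodal_chains k l"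
  by (simp add: antipodal_chains_def bd_half_chains rev.bd_half_chains)

definition restrict_half :: "('a list \<Rightarrow> int) \<Rightarrow> 'a list \<Rightarrow> int" where
  "restrict_half c xs = (if first_arc xs \<le> m then c xs else 0)"

lemma additive_restrict_half: "additive restrict_half"
  by standard (simp add: fun_eq_iff restrict_half_def)

lemma restrict_half_half_chains: "c \<in> chains k l \<Longrightarrow> restrict_half c \<in> half_chains k l"
  by (simp add: half_chains_def chains_def supported_on_def restrict_half_def)

lemma diff_restrict_half_half_chains:
  assumes "c \<in> chains k l"
  shows "c - restrict_half c \<in> rev.half_chains k l"
proof -
  have "xs \<in> generators k l \<and> rev.first_arc xs \<le> m" if nz: "(c - restrict_half c) xs \<noteq> 0" for xs
  proof -
    have xs: "xs \<in> generators k l" "\<not> first_arc xs \<le> m"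
      using nz supported_onD[OF assms[unfolded chains_def], of xs]
      by (auto simp: restrict_half_def split: if_splits)
    then obtain x y t where "xs = x # y # t" by (cases xs rule: first_arc.cases) auto
    then show ?thesis using xs arc_swap[of x y] by (simp add: generators_def)
  qed
  then show ?thesis by (auto simp: rev.half_chains_def supported_on_def)
qed

lemma bd_restrict_half_antipodal:
  assumes "c \<in> chains (Suc k) l" "bd c \<in> rev.half_chains k l"
  shows "bd (restrict_half c) \<in> antipodal_chains k l"
proof -
  have "bd (restrict_half c) \<in> half_chains k l"
    using assms(1) by (intro bd_half_chains restrict_half_half_chains)
  moreover have "bd c - bd (c - restrict_half c) \<in> rev.half_chains k l"
    using assms(2) rev.bd_half_chains[OF diff_restrict_half_half_chains[OF assms(1)]]
    by (rule rev.half_chains_diff)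
  ultimately show ?thesis by (simp add: antipodal_chains_def bd.diff)
qed

lemma boundary_if_restrict_half_boundary:
  assumes c: "c \<in> chains (Suc k) l" "bd c = 0" and "Suc k < l"
    and i: "i \<in> antipodal_chains (Suc k) l" "bd (restrict_half c) = bd i"
  shows "c \<in> boundaries chains (Suc k) l"
proof -
  note exact = half_chains_exact[OF \<open>Suc k < l\<close>]
  have "restrict_half c - i \<in> half_chains (Suc k) l" "bd (restrict_half c - i) = 0"
    using restrict_half_half_chains[OF c(1)] i
    by (auto simp: antipodal_chains_def half_chains_diff bd.diff)
  then obtain u where u: "u \<in> half_chains (Suc (Suc k)) l" "bd u = restrict_half c - i"
    using exact by (blast elim: exact_atE)
  have "c - restrict_half c + i \<in> rev.half_chains (Suc k) l" "bd (c - restrict_half c + i) = 0"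
    using diff_restrict_half_half_chains[OF c(1)] i c(2)
    by (auto simp: antipodal_chains_def rev.half_chains_add bd.diff bd.add)
  then obtain w where w: "w \<in> rev.half_chains (Suc (Suc k)) l" "bd w = c - restrict_half c + i"
    using exact by (blast elim: exact_atE)
  have "u + w \<in> chains (Suc (Suc k)) l"
    using u(1) w(1) half_chains_subset_chains rev.half_chains_subset_chains
    by (blast intro: chains_add)
  moreover have "bd (u + w) = c" by (simp add: bd.add u w)
  ultimately show ?thesis by (metis image_eqI)
qed

lemma restrict_half_boundary_if_boundary:
  assumes w: "w \<in> chains (Suc (Suc k)) l"
  shows "bd (restrict_half (bd w)) \<in> boundaries antipodal_chains k l"
proof -
  define i where "i = restrict_half (bd w) - bd (restrict_half w)"
  have bd_w: "bd w \<in> chains (Suc k) l" using w by (rule bd_chains)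
  have "i \<in> half_chains (Suc k) l"
    unfolding i_def using bd_w w
    by (intro half_chains_diff bd_half_chains restrict_half_half_chains)
  moreover have
    "bd (w - restrict_half w) - (bd w - restrict_half (bd w)) \<in> rev.half_chains (Suc k) l"
    using rev.bd_half_chains[OF diff_restrict_half_half_chains[OF w]]
      diff_restrict_half_half_chains[OF bd_w]
    by (rule rev.half_chains_diff)
  then have "i \<in> rev.half_chains (Suc k) l" by (simp add: i_def bd.diff)
  moreover have "bd (restrict_half (bd w)) = bd i" by (simp add: i_def bd.diff bd_bd)
  ultimately show ?thesis by (auto simp: antipodal_chains_def)
qed

lemma connecting_map_onto:
  assumes y: "y \<in> antipodal_chains k l" "bd y = 0" and "k < l"
  shows "\<exists>c\<in>chains (Suc k) l. bd c = 0 \<and> bd (restrict_half c) - y \<in> boundaries antipodal_chains k l"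
proof -
  note exact = half_chains_exact[OF \<open>k < l\<close>]
  obtain u w where u: "u \<in> half_chains (Suc k) l" "bd u = y"
    and w: "w \<in> rev.half_chains (Suc k) l" "bd w = y"
    using exact y unfolding antipodal_chains_def by (blast elim: exact_atE)
  define c where "c = u - w"
  have c: "c \<in> chains (Suc k) l"
    unfolding c_def using u(1) w(1) half_chains_subset_chains rev.half_chains_subset_chains
    by (blast intro: chains_diff)
  define e where "e = restrict_half c - u"
  have "e \<in> half_chains (Suc k) l"
    unfolding e_def using c u(1) by (intro half_chains_diff restrict_half_half_chains)
  moreover have "0 - (c - restrict_half c) - w \<in> rev.half_chains (Suc k) l"
    using rev.half_chains_diff[OF rev.half_chains_zero diff_restrict_half_half_chains[OF c]] w(1)
    by (rule rev.half_chains_diff)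
  then have "e \<in> rev.half_chains (Suc k) l" by (simp add: e_def c_def)
  moreover have "bd (restrict_half c) - y = bd e" by (simp add: e_def bd.diff u(2))
  moreover have "bd c = 0" using u(2) w(2) by (simp add: c_def bd.diff)
  ultimately show ?thesis using c unfolding antipodal_chains_def by blast
qed

theorem free_homology_Mayer_Vietoris:
  assumes "free_homology antipodal_chains k l A" "Suc k < l"
  shows "free_homology chains (Suc k) l A"
  unfolding free_homology_def
proof (rule free_quotient_transport[where F = "\<lambda>c. bd (restrict_half c)"])
  show "free_quotient (cycles antipodal_chains k l) (boundaries antipodal_chains k l) A"
    using assms(1) unfolding free_homology_def .
  show "additive (\<lambda>c. bd (restrict_half c))"
    by (rule additive_compose[OF additive_restrict_half additive_bd])
  show "(\<lambda>c. bd (restrict_half c)) ` cycles chains (Suc k) l \<subseteq> cycles antipodal_chains k l"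
    by (auto simp: bd_bd intro: bd_restrict_half_antipodal)
  show "boundaries antipodal_chains k l \<subseteq> cycles antipodal_chains k l"
    by (auto simp: bd_bd bd_antipodal_chains)
  show "bd (restrict_half c) \<in> boundaries antipodal_chains k l \<longleftrightarrow> c \<in> boundaries chains (Suc k) l"
    if "c \<in> cycles chains (Suc k) l" for c
    using that boundary_if_restrict_half_boundary[OF _ _ assms(2)]
      restrict_half_boundary_if_boundary by auto
  show "\<exists>c\<in>cycles chains (Suc k) l. bd (restrict_half c) - y \<in> boundaries antipodal_chains k l"
    if "y \<in> cycles antipodal_chains k l" for y
    using that connecting_map_onto[of y k l] assms(2) by auto
qed

subsection \<open>The antipodal complex as a shifted copy\<close>

lemma bd_prepend_antipode: "bd (prepend m g) = - prepend m (bd g)"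
proof (rule bd_prepend)
  fix x v y t assume v: "v \<in> between x y" "arc x v = m"
  then show "g (v # y # t) = 0" using between_iff_arc[of x v y] betweenD[OF v(1)] by simp
qed

lemma prepend_antipode_chains: "g \<in> chains k l \<Longrightarrow> prepend m g \<in> antipodal_chains (Suc k) (l + m)"
  unfolding antipodal_chains_Suc using m_ge_2 by (intro prepend_step_chains) auto

lemma drop_antipode_chains: "c \<in> antipodal_chains (Suc k) (l + m) \<Longrightarrow> drop_first c \<in> chains k l"
  using drop_first_chains[of m c k "l + m"] m_ge_2 by (simp add: antipodal_chains_Suc)

lemma prepend_drop_antipode: "c \<in> antipodal_chains (Suc k) l \<Longrightarrow> prepend m (drop_first c) = c"
  by (simp add: antipodal_chains_Suc prepend_drop_first)

lemma drop_prepend_antipode: "g \<in> chains k l \<Longrightarrow> drop_first (prepend m g) = g"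
  using m_ge_2 by (intro drop_first_prepend) auto

lemma bd_drop_antipode:
  assumes "c \<in> antipodal_chains (Suc k) (l + m)"
  shows "bd (drop_first c) = - drop_first (bd c)"
proof -
  have "bd (drop_first c) = drop_first (prepend m (bd (drop_first c)))"
    using drop_prepend_antipode[OF bd_chains_pred[OF drop_antipode_chains[OF assms]]] by simp
  also have "prepend m (bd (drop_first c)) = - bd c"
    using bd_prepend_antipode[of "drop_first c"] by (simp add: prepend_drop_antipode[OF assms])
  finally show ?thesis by (simp only: additive.minus[OF additive_drop_first])
qed

lemma drop_antipode_boundary_iff:
  assumes c: "c \<in> antipodal_chains (Suc k) (l + m)"
  shows "drop_first c \<in> boundaries chains k l \<longleftrightarrow> c \<in> boundaries antipodal_chains (Suc k) (l + m)"
proof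
  assume "drop_first c \<in> boundaries chains k l"
  then obtain g where g: "g \<in> chains (Suc k) l" "drop_first c = bd g" by blast
  have "- g \<in> chains (Suc k) l" using g(1) by (rule chains_minus)
  then have "prepend m (- g) \<in> antipodal_chains (Suc (Suc k)) (l + m)"
    by (rule prepend_antipode_chains)
  moreover have "bd (prepend m (- g)) = c"
    using bd_prepend_antipode[of g] prepend_drop_antipode[OF c] g(2)
    by (simp add: additive.minus[OF additive_prepend] bd.minus)
  ultimately show "c \<in> boundaries antipodal_chains (Suc k) (l + m)" by blast
next
  assume "c \<in> boundaries antipodal_chains (Suc k) (l + m)"
  then obtain e where e: "e \<in> antipodal_chains (Suc (Suc k)) (l + m)" "c = bd e" by blast
  have "- drop_first e \<in> chains (Suc k) l"
    using drop_antipode_chains[OF e(1)] by (rule chains_minus)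
  moreover have "drop_first c = bd (- drop_first e)"
    using bd_drop_antipode[OF e(1)] e(2) by (simp add: bd.minus)
  ultimately show "drop_first c \<in> boundaries chains k l" by blast
qed

theorem free_homology_antipodal:
  assumes "free_homology chains k l A"
  shows "free_homology antipodal_chains (Suc k) (l + m) A"
  unfolding free_homology_def
proof (rule free_quotient_transport[where F = drop_first])
  show "free_quotient (cycles chains k l) (boundaries chains k l) A"
    using assms unfolding free_homology_def .
  show "drop_first ` cycles antipodal_chains (Suc k) (l + m) \<subseteq> cycles chains k l"
    by (auto simp: drop_antipode_chains bd_drop_antipode additive.zero[OF additive_drop_first])
  show "boundaries chains k l \<subseteq> cycles chains k l"
    by (auto simp: bd_chains bd_bd)
  show "\<exists>c\<in>cycles antipodal_chains (Suc k) (l + m). drop_first c - y \<in> boundaries chains k l"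
    if y: "y \<in> cycles chains k l" for y
  proof
    show "prepend m y \<in> cycles antipodal_chains (Suc k) (l + m)"
      using y by (simp add: prepend_antipode_chains bd_prepend_antipode
          additive.zero[OF additive_prepend])
    have "drop_first (prepend m y) - y = bd 0"
      using y by (simp add: drop_prepend_antipode[of y k l] bd.zero)
    then show "drop_first (prepend m y) - y \<in> boundaries chains k l"
      by (metis chains_zero image_eqI)
  qed
qed (simp_all add: additive_drop_first drop_antipode_boundary_iff)

lemma antipodal_chains_trivial:
  assumes "k = 0 \<and> 0 < l \<or> 0 < k \<and> l < m"
  shows "antipodal_chains k l = {0}"
proof (cases k)
  case 0
  then have "antipodal_chains k l \<subseteq> {0}"
    using half_chains_subset_chains[of 0 l] assms
    by (auto simp: antipodal_chains_def chains_0_trivial)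
  moreover have "0 \<in> antipodal_chains k l"
    by (simp add: antipodal_chains_def)
  ultimately show ?thesis by blast
next
  case (Suc k')
  have "first_arc xs \<noteq> m" if xs: "xs \<in> generators (Suc k') l" for xs
  proof -
    obtain x y t where "xs = x # y # t" using xs by (rule generators_SucE)
    then show ?thesis
      using xs assms Suc Cons_Cons_step_generators_iff[of m x y t k' l] m_ge_2 by auto
  qed
  then have "{xs \<in> generators (Suc k') l. first_arc xs = m} = {}" by blast
  then show ?thesis
    unfolding Suc antipodal_chains_Suc step_chains_def by (simp only: supported_on_empty)
qed

subsection \<open>The magnitude homology of an even cycle\<close>

lemma d_eq_1_iff: "x \<in> V \<Longrightarrow> y \<in> V \<Longrightarrow> d x y = 1 \<longleftrightarrow> arc x y = 1 \<or> arc x y + 1 = 2 * m"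
  using d_eq_arc[of x y] m_ge_2 arc_less[of x y] by auto

lemma between_two_unit_steps:
  assumes "3 \<le> m" and V: "x \<in> V" "v \<in> V" "z \<in> V" and d: "d x v = 1" "d v z = 1" and "x \<noteq> z"
  shows "between x z = {v}"
proof -
  have two_steps: "arc x w = 1 \<and> arc x z = 2 \<or> arc x w + 1 = 2 * m \<and> arc x z + 2 = 2 * m"
    if w: "w \<in> V" "d x w = 1" "d w z = 1" for w
  proof -
    have "arc x w = 1 \<or> arc x w + 1 = 2 * m" "arc w z = 1 \<or> arc w z + 1 = 2 * m"
      using w V d_eq_1_iff by blast+
    moreover have "arc x z \<noteq> 0" "arc x z < 2 * m"
      using V \<open>x \<noteq> z\<close> arc_eq_0_iff arc_less by auto
    moreover have "arc x w + arc w z = arc x z \<or> arc x w + arc w z = arc x z + 2 * m"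
      using arc_add w(1) V by blast
    ultimately show ?thesis using assms(1) by arith
  qed
  have dist: "d x z = 2" using two_steps[OF V(2) d] assms(1) d_eq_arc[OF V(1,3)] by auto
  have "w = v" if "w \<in> between x z" for w
  proof -
    have w: "w \<in> V" "0 < d x w" "0 < d w z" "d x w + d w z = 2"
      using that between_iff[OF V(1) betweenD(1)[OF that] V(3)] betweenD(1)[OF that] dist by auto
    then have "d x w = 1" "d w z = 1" by linarith+
    then have "arc x w = arc x v"
      using two_steps[OF w(1)] two_steps[OF V(2) d] assms(1) by arith
    then show ?thesis using arc_inject[OF V(1) w(1) V(2)] by simp
  qed
  moreover have "v \<in> between x z" using V d dist by (simp add: between_iff)
  ultimately show ?thesis by blast
qed

lemma unique_midpoints: "3 \<le> m \<Longrightarrow> unique_midpoints"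
  unfolding unique_midpoints_def using between_two_unit_steps by blast

lemma card_vertices: "card V = 2 * m"
proof -
  obtain x where x: "x \<in> V" using vertices_nonempty by blast
  have "inj_on (arc x) V" using x arc_inject[of x] by (intro inj_onI) blast
  moreover have "arc x ` V = {..<2 * m}" using x arc_less[OF x] ex_arc_from[OF x] by force
  ultimately show ?thesis by (metis card_image card_lessThan)
qed

lemma card_edges: "card edges = 4 * m"
proof -
  have "card {y \<in> V. d x y = 1} = 2" if x: "x \<in> V" for x
  proof -
    obtain p q where pq: "p \<in> V" "arc x p = 1" "q \<in> V" "arc x q + 1 = 2 * m"
      using ex_arc_from[OF x, of 1] ex_arc_from[OF x, of "2 * m - 1"] m_ge_2 by force
    then have "y = p \<or> y = q" if "y \<in> V" "d x y = 1" for y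
      using that x d_eq_1_iff[of x y] arc_inject[of x y p] arc_inject[of x y q] by auto
    moreover have "d x p = 1" "d x q = 1" using pq x d_eq_1_iff by blast+
    ultimately have "{y \<in> V. d x y = 1} = {p, q}" using pq by blast
    moreover have "p \<noteq> q" using pq m_ge_2 by auto
    ultimately show ?thesis by simp
  qed
  moreover have "edges = (SIGMA x:V. {y \<in> V. d x y = 1})" by (auto simp: edges_def)
  ultimately show ?thesis using card_vertices finite_V by simp
qed

theorem free_homology_periodic:
  assumes "free_homology chains k l A" "Suc (Suc k) < l + m"
  shows "free_homology chains (Suc (Suc k)) (l + m) A"
  using free_homology_antipodal[OF assms(1)] assms(2) by (rule free_homology_Mayer_Vietoris)

lemma free_homology_vanishing:
  assumes "l < k \<or> k < l \<and> (k \<le> 1 \<or> l < m)"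
  shows "free_homology chains k l ({} :: 'b set)"
proof -
  consider (below_diagonal) "l < k" | (degree_zero) "k = 0" "k < l"
    | (positive_degree) k' where "k = Suc k'" "k < l" "k' = 0 \<or> l < m"
    using assms by (cases k) auto
  then show ?thesis
  proof cases
    case below_diagonal
    then show ?thesis by (intro free_homology_chains_trivial chains_trivial)
  next
    case degree_zero
    then show ?thesis by (simp add: free_homology_chains_trivial chains_0_trivial)
  next
    case positive_degree
    have "free_homology antipodal_chains k' l ({} :: 'b set)"
    proof (rule free_homology_if_trivial)
      show "antipodal_chains k' l = {0}"
        using positive_degree by (intro antipodal_chains_trivial) auto
      show "0 \<in> antipodal_chains (Suc k') l" by (simp add: antipodal_chains_def)
      show "boundaries antipodal_chains k' l \<subseteq> antipodal_chains k' l"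
        using bd_antipodal_chains by blast
    qed
    then show ?thesis using positive_degree by (simp add: free_homology_Mayer_Vietoris)
  qed
qed

theorem free_homology_T_fun:
  assumes "3 \<le> m"
  shows "\<exists>A :: 'a list set. finite A \<and> free_homology chains k l A \<and>
    int (card A) = T_fun (int m) (int k) (int l)"
proof (induction k arbitrary: l rule: less_induct)
  case (less k)
  consider (vanishing) "l < k \<or> k < l \<and> (k \<le> 1 \<or> l < m)" | (diagonal) "l = k"
    | (periodic) "2 \<le> k" "m \<le> l" "k < l" by linarith
  then show ?case
  proof cases
    case vanishing
    then have "free_homology chains k l ({} :: 'a list set)" by (rule free_homology_vanishing)
    moreover have "T_fun (int m) (int k) (int l) = 0"
      using vanishing assms by (intro T_fun_vanishing) auto
    ultimately show ?thesis by (intro exI[of _ "{}"]) simp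
  next
    case diagonal
    have "free_homology chains k k (backtracking_walks k)"
      by (rule free_homology_diagonal[OF unique_midpoints[OF assms]])
    moreover have "int (card (backtracking_walks k)) = T_fun (int m) (int k) (int k)"
      using assms by (simp add: card_backtracking_walks card_vertices card_edges T_fun_on_diagonal)
    ultimately show ?thesis using diagonal finite_backtracking_walks by blast
  next
    case periodic
    then obtain k' l' where kl: "k = Suc (Suc k')" "l = l' + m"
      by (metis add_2_eq_Suc le_add_diff_inverse le_add_diff_inverse2)
    then obtain A :: "'a list set" where A: "finite A" "free_homology chains k' l' A"
        "int (card A) = T_fun (int m) (int k') (int l')"
      using less.IH[of k' l'] by auto
    have "T_fun (int m) (int k) (int l) = T_fun (int m) (int k') (int l')"
      using T_fun_above_diagonal[of "int m" "int k" "int l"] periodic kl by simp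
    moreover have "free_homology chains k l A"
      using free_homology_periodic[OF A(2)] periodic kl by simp
    ultimately show ?thesis using A by auto
  qed
qed

theorem mh_even_cycle:
  assumes "3 \<le> m"
  shows "mh_torsion_free V d k l" "int (mh_rank V d k l) = T_fun (int m) k l"
proof -
  have "\<exists>A :: 'a list set. finite A \<and> free_quotient (mh_cycles V d k l) (mh_boundaries V d k l) A \<and>
      int (card A) = T_fun (int m) k l"
  proof (cases "k < 0 \<or> l < 0")
    case True
    then show ?thesis
      using free_quotient_mh_negative[OF True] T_fun_negative[OF True]
      by (intro exI[of _ "{}"]) simp
  next
    case False
    then obtain k' l' where kl: "k = int k'" "l = int l'" by (metis nonneg_int_cases not_less)
    show ?thesis
      unfolding kl using free_homology_T_fun[OF assms] free_quotient_mh_if_free_homology by blast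
  qed
  then obtain A :: "'a list set" where A: "finite A"
      "free_quotient (mh_cycles V d k l) (mh_boundaries V d k l) A"
      "int (card A) = T_fun (int m) k l"
    by blast
  show "mh_torsion_free V d k l" by (rule mh_torsion_free_if_free_quotient[OF A(2)])
  show "int (mh_rank V d k l) = T_fun (int m) k l" using mh_rank_eq_card[OF A(2,1)] A(3) by simp
qed

end

subsection \<open>Distances in a cycle graph\<close>

definition cycle_arc :: "nat \<Rightarrow> nat \<Rightarrow> nat \<Rightarrow> nat" where
  "cycle_arc n x y = (if x \<le> y then y - x else y + n - x)"

lemma cycle_arc_less: "x < n \<Longrightarrow> y < n \<Longrightarrow> cycle_arc n x y < n"
  by (auto simp: cycle_arc_def)

lemma cycle_arc_eq_0_iff: "x < n \<Longrightarrow> cycle_arc n x y = 0 \<longleftrightarrow> x = y"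
  by (auto simp: cycle_arc_def)

lemma cycle_arc_add:
  "x < n \<Longrightarrow> y < n \<Longrightarrow> z < n \<Longrightarrow> cycle_arc n x y + cycle_arc n y z = cycle_arc n x z
    \<or> cycle_arc n x y + cycle_arc n y z = cycle_arc n x z + n"
  by (auto simp: cycle_arc_def)

lemma add_cycle_arc_mod: "x < n \<Longrightarrow> y < n \<Longrightarrow> (x + cycle_arc n x y) mod n = y"
  by (simp add: cycle_arc_def)

lemma ex_cycle_arc: "x < n \<Longrightarrow> j < n \<Longrightarrow> \<exists>y<n. cycle_arc n x y = j"
  by (rule exI[of _ "(x + j) mod n"]) (auto simp: cycle_arc_def mod_if)

lemma is_walk_Cons_Cons:
  "is_walk V E (x # y # t) \<longleftrightarrow> x \<in> V \<and> E x y \<and> is_walk V E (y # t)"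
  unfolding is_walk_def by (auto simp: nth_Cons split: nat.splits)

lemma is_walk_rev:
  assumes "symp E" "is_walk V E p"
  shows "is_walk V E (rev p)"
proof -
  have "E (rev p ! i) (rev p ! Suc i)" if i: "Suc i < length p" for i
  proof -
    have "E (p ! (length p - Suc (Suc i))) (p ! Suc (length p - Suc (Suc i)))"
      using assms(2) i unfolding is_walk_def by auto
    moreover have "Suc (length p - Suc (Suc i)) = length p - Suc i" using i by simp
    ultimately have "E (rev p ! Suc i) (rev p ! i)" using i by (simp add: rev_nth)
    then show ?thesis by (rule sympD[OF assms(1)])
  qed
  then show ?thesis using assms(2) by (auto simp: is_walk_def)
qed

lemma symp_cycle_E: "symp (cycle_E n)"
  by (auto simp: symp_def cycle_E_def)

lemma cycle_E_cases:
  assumes "cycle_E n x z"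
  obtains "Suc x < n" "z = Suc x" | "Suc x = n" "z = 0"
    | "Suc z < n" "x = Suc z" | "Suc z = n" "x = 0"
  using assms by (auto simp: cycle_E_def mod_Suc split: if_splits)

lemma min_cycle_arc_step:
  assumes "cycle_E n x z" "y < n"
  shows "min (cycle_arc n x y) (cycle_arc n y x) \<le> Suc (min (cycle_arc n z y) (cycle_arc n y z))"
  using assms(1) by (cases rule: cycle_E_cases) (use assms(2) in \<open>auto simp: cycle_arc_def\<close>)

lemma min_cycle_arc_less_length:
  assumes "is_walk (cycle_V n) (cycle_E n) p"
  shows "min (cycle_arc n (hd p) (last p)) (cycle_arc n (last p) (hd p)) < length p"
  using assms
proof (induction p rule: induct_list012)
  case (3 x z t)
  then have walk: "cycle_E n x z" "is_walk (cycle_V n) (cycle_E n) (z # t)"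
    by (simp_all add: is_walk_Cons_Cons)
  then have "last (z # t) < n"
    using last_in_set[of "z # t"] by (auto simp: is_walk_def cycle_V_def)
  then show ?case using min_cycle_arc_step[OF walk(1)] "3.IH"(2)[OF walk(2)] by fastforce
qed (auto simp: is_walk_def cycle_arc_def)

lemma ex_cycle_walk:
  assumes "x < n" "y < n"
  shows "\<exists>p. is_walk (cycle_V n) (cycle_E n) p \<and> length p = Suc (cycle_arc n x y) \<and>
    hd p = x \<and> last p = y"
proof -
  let ?p = "map (\<lambda>i. (x + i) mod n) [0..<Suc (cycle_arc n x y)]"
  have "is_walk (cycle_V n) (cycle_E n) ?p"
    using assms by (auto simp: is_walk_def cycle_V_def cycle_E_def mod_Suc_eq simp del: upt_Suc)
  moreover have "hd ?p = x" using assms by (simp add: hd_map del: upt_Suc)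
  moreover have "last ?p = y" using assms by (simp add: add_cycle_arc_mod)
  ultimately show ?thesis by (intro exI[of _ ?p]) simp
qed

lemma cycle_dist_eq:
  assumes "x < n" "y < n"
  shows "cycle_dist n x y = min (cycle_arc n x y) (cycle_arc n y x)"
  unfolding cycle_dist_def graph_dist_def
proof (rule Least_equality)
  let ?walk = "\<lambda>p j. is_walk (cycle_V n) (cycle_E n) p \<and> length p = Suc j \<and> hd p = x \<and> last p = y"
  obtain p where p: "?walk p (cycle_arc n x y)" using ex_cycle_walk[OF assms] by blast
  obtain q where q: "is_walk (cycle_V n) (cycle_E n) q" "length q = Suc (cycle_arc n y x)"
      "hd q = y" "last q = x"
    using ex_cycle_walk[OF assms(2,1)] by blast
  then have "q \<noteq> []" by auto
  then have "?walk (rev q) (cycle_arc n y x)"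
    using q is_walk_rev[OF symp_cycle_E] by (simp add: hd_rev last_rev)
  then show "\<exists>p. ?walk p (min (cycle_arc n x y) (cycle_arc n y x))"
    using p by (metis min_def)
  show "min (cycle_arc n x y) (cycle_arc n y x) \<le> j" if "\<exists>p. ?walk p j" for j
    using that min_cycle_arc_less_length by fastforce
qed

lemma even_cycle_cycle_graph:
  assumes "2 \<le> m"
  shows "even_cycle (cycle_V (2 * m)) (cycle_dist (2 * m)) m (cycle_arc (2 * m))"
proof
  show "cycle_V (2 * m) \<noteq> {}" using assms by (simp add: cycle_V_def lessThan_empty_iff bot_nat_def)
  show "\<exists>y\<in>cycle_V (2 * m). cycle_arc (2 * m) x y = j" if "x \<in> cycle_V (2 * m)" "j < 2 * m" for x j
    using ex_cycle_arc[of x "2 * m" j] that by (auto simp: cycle_V_def)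
qed (use assms in \<open>auto simp: cycle_V_def cycle_arc_less cycle_arc_eq_0_iff cycle_arc_add
    cycle_dist_eq\<close>)

theorem theorem3p6:
  fixes m :: nat
  assumes "m \<ge> 3"
  shows "(\<forall>k l. mh_torsion_free (cycle_V (2 * m)) (cycle_dist (2 * m)) k l) \<and>
         (\<forall>k l. int (mh_rank (cycle_V (2 * m)) (cycle_dist (2 * m)) k l) = T_fun (int m) k l)"
proof -
  interpret even_cycle "cycle_V (2 * m)" "cycle_dist (2 * m)" m "cycle_arc (2 * m)"
    using assms by (intro even_cycle_cycle_graph) simp
  show ?thesis using mh_even_cycle[OF assms] by blast
qed

end
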